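(* Let $B$ be a skew left brace and let $G=(B,\star)\rtimes(B,\cdot)$ act on $B$ via $\Theta$. Let $\mathcal{O}$ be the set of orbits, and for each $i\in\mathcal{O}$ fix an element $a_i\in i$, with stabilizer $\operatorname{St}(a_i)\leq G$. Let $I\subseteq\mathcal{O}$ be non-empty with $\bigcup_{i\in I}i$ generating $(B,\star)$, and for each $i\in I$ let $J_i$ be a non-empty set and $\{K_{i,j}\}_{j\in J_i}$ a family of subgroups of $\operatorname{St}(a_i)$ with $$\left\{a\in B:(1,a),(a,a)\in\bigcap_{i\in I}\bigcap_{j\in J_i}\operatorname{core}_G(K_{i,j})\right\}=\{1\}.$$ Assume moreover that $$(1,\Theta_{(b,c)}(a_i))\in(b,c)K_{i,j}(b,c)^{-1}\quad\text{and}\quad(\Theta_{(b,c)}(a_i),\Theta_{(b,c)}(a_i))\in(b,c)K_{i,j}(b,c)^{-1}$$ for all $b,c\in B$, $i\in I$, $j\in J_i$. Let $X=\bigsqcup_{i\in I}\bigsqcup_{j\in J_i}G/K_{i,j}$ be the disjoint union of the sets of left cosets and let $r(x,y)=(f_x(y),g_y(x))$, where for $x=(b_1,c_1)K_{i_1,j_1}$ and $y=(b_2,c_2)K_{i_2,j_2}$ in $X$, setting $u=\Theta_{(b_1,c_1)}(a_{i_1})$ and $w=\Theta_{(1,u)}\Theta_{(b_2,c_2)}(a_{i_2})$, $$f_x(y)=(1,u)(b_2,c_2)K_{i_2,j_2},\qquad g_y(x)=(w,w)^{-1}(b_1,c_1)K_{i_1,j_1}.$$ Then the non-degenerate solution $(X,r)$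 is square-free. Moreover, any square-free non-degenerate solution is, up to isomorphism, constructed in this way (from some skew left brace $B$ and some choice of such data).
   Context: A skew left brace is a set $B$ with two binary operations $\star,\cdot$ such that $(B,\star)$ and $(B,\cdot)$ are groups and $a\cdot(b\star c)=(a\cdot b)\star a^\star\star(a\cdot c)$ for all $a,b,c\in B$, where $a^\star$ is the inverse of $a$ in $(B,\star)$. The two identity elements coincide and are denoted $1$. Put $\lambda_a(b)=a^\star\star(a\cdot b)$; then $a\mapsto\lambda_a$ is a group morphism $(B,\cdot)\to\operatorname{Aut}(B,\star)$. The semidirect product $G=(B,\star)\rtimes(B,\cdot)$ has product $(a,b)(a',b')=(a\star\lambda_b(a'),\,b\cdot b')$, and acts on $B$ by automorphisms of $(B,\star)$ via $\Theta_{(a,b)}(c)=a\star\lambda_b(c)\star a^\star$. For $H\leq G$, $\operatorname{core}_G(H)=\bigcap_{g\in G}gHg^{-1}$. A solution (of the Yang-Baxter equation) is a pair $(X,r)$ with $X$ non-empty and $r:X\times X\to X\times X$ bijective with $r_1r_2r_1=r_2r_1r_2$ on $X^3$, where $r_1=r\times\operatorname{id}$, $r_2=\operatorname{id}\times r$. Write $r(x,y)=(f_x(y),g_y(x))$; it is non-degenerate if all $f_x,g_x$ are bijective, and a non-degenerate solution is square-free if $r(x,x)=(x,x)$ for all $x\in X$. Solutions $(X,r)$ and $(Y,s)$ are isomorphic if there is a bijection $F:X\to Y$ with $s(F(x_1),F(x_2))=(F\times F)(r(x_1,x_2))$ for all $x_1,x_2\in X$. (The pair $(X,r)$ constructed in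 the claim is known to be a non-degenerate solution.) *)

theory Defs
  imports
    "HOL-Algebra.Group_Action"
    "HOL-Algebra.Generated_Groups"
    "HOL-Algebra.Left_Coset"
begin

section \<open>Skew left braces\<close>

text \<open>\<open>A\<close> is the group $(B,\star)$ and \<open>M\<close> is the group $(B,\cdot)$ on the same carrier.\<close>

locale skew_left_brace = add: group A + mul: group M
  for A :: "'b monoid" and M :: "'b monoid" +
  assumes carrier_eq: "carrier M = carrier A"
    and compat: "\<lbrakk>a \<in> carrier A; b \<in> carrier A; c \<in> carrier A\<rbrakk> \<Longrightarrow>
      a \<otimes>\<^bsub>M\<^esub> (b \<otimes>\<^bsub>A\<^esub> c) = (a \<otimes>\<^bsub>M\<^esub> b) \<otimes>\<^bsub>A\<^esub> inv\<^bsub>A\<^esub> a \<otimes>\<^bsub>A\<^esub> (a \<otimes>\<^bsub>M\<^esub> c)"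

definition brace_lambda :: "'b monoid \<Rightarrow> 'b monoid \<Rightarrow> 'b \<Rightarrow> 'b \<Rightarrow> 'b" where
  "brace_lambda A M a b = inv\<^bsub>A\<^esub> a \<otimes>\<^bsub>A\<^esub> (a \<otimes>\<^bsub>M\<^esub> b)"

definition brace_semidirect :: "'b monoid \<Rightarrow> 'b monoid \<Rightarrow> ('b \<times> 'b) monoid" where
  "brace_semidirect A M =
    \<lparr>carrier = carrier A \<times> carrier M,
     mult = (\<lambda>(a, b) (a', b'). (a \<otimes>\<^bsub>A\<^esub> brace_lambda A M b a', b \<otimes>\<^bsub>M\<^esub> b')),
     one = (\<one>\<^bsub>A\<^esub>, \<one>\<^bsub>M\<^esub>)\<rparr>"

definition brace_Theta :: "'b monoid \<Rightarrow> 'b monoid \<Rightarrow> 'b \<times> 'b \<Rightarrow> 'b \<Rightarrow> 'b" where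
  "brace_Theta A M = (\<lambda>(a, b) c. a \<otimes>\<^bsub>A\<^esub> brace_lambda A M b c \<otimes>\<^bsub>A\<^esub> inv\<^bsub>A\<^esub> a)"

definition conjugate_set :: "('g, 'm) monoid_scheme \<Rightarrow> 'g \<Rightarrow> 'g set \<Rightarrow> 'g set" where
  "conjugate_set G g H = (g <#\<^bsub>G\<^esub> H) #>\<^bsub>G\<^esub> inv\<^bsub>G\<^esub> g"

definition normal_core :: "('g, 'm) monoid_scheme \<Rightarrow> 'g set \<Rightarrow> 'g set" where
  "normal_core G H = (\<Inter>g\<in>carrier G. conjugate_set G g H)"


section \<open>Solutions of the Yang-Baxter equation\<close>

text \<open>The carrier is an explicit set \<open>X\<close>; values of \<open>r\<close> outside \<open>X \<times> X\<close> are irrelevant.\<close>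

definition yb_r1 :: "('x \<times> 'x \<Rightarrow> 'x \<times> 'x) \<Rightarrow> 'x \<times> 'x \<times> 'x \<Rightarrow> 'x \<times> 'x \<times> 'x" where
  "yb_r1 r = (\<lambda>(x, y, z). (fst (r (x, y)), snd (r (x, y)), z))"

definition yb_r2 :: "('x \<times> 'x \<Rightarrow> 'x \<times> 'x) \<Rightarrow> 'x \<times> 'x \<times> 'x \<Rightarrow> 'x \<times> 'x \<times> 'x" where
  "yb_r2 r = (\<lambda>(x, y, z). (x, r (y, z)))"

definition yb_solution :: "'x set \<Rightarrow> ('x \<times> 'x \<Rightarrow> 'x \<times> 'x) \<Rightarrow> bool" where
  "yb_solution X r \<longleftrightarrow>
     X \<noteq> {} \<and> bij_betw r (X \<times> X) (X \<times> X) \<and>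
     (\<forall>t \<in> X \<times> X \<times> X. yb_r1 r (yb_r2 r (yb_r1 r t)) = yb_r2 r (yb_r1 r (yb_r2 r t)))"

definition nondegenerate_solution :: "'x set \<Rightarrow> ('x \<times> 'x \<Rightarrow> 'x \<times> 'x) \<Rightarrow> bool" where
  "nondegenerate_solution X r \<longleftrightarrow>
     yb_solution X r \<and>
     (\<forall>x\<in>X. bij_betw (\<lambda>y. fst (r (x, y))) X X) \<and>
     (\<forall>y\<in>X. bij_betw (\<lambda>x. snd (r (x, y))) X X)"

definition square_free_solution :: "'x set \<Rightarrow> ('x \<times> 'x \<Rightarrow> 'x \<times> 'x) \<Rightarrow> bool" where
  "square_free_solution X r \<longleftrightarrow> nondegenerate_solution X r \<and> (\<forall>x\<in>X. r (x, x) = (x, x))"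

definition isomorphic_solutions ::
  "'x set \<Rightarrow> ('x \<times> 'x \<Rightarrow> 'x \<times> 'x) \<Rightarrow> 'y set \<Rightarrow> ('y \<times> 'y \<Rightarrow> 'y \<times> 'y) \<Rightarrow> bool" where
  "isomorphic_solutions X r Y s \<longleftrightarrow>
     (\<exists>F. bij_betw F X Y \<and>
          (\<forall>x1\<in>X. \<forall>x2\<in>X. s (F x1, F x2) = map_prod F F (r (x1, x2))))"


section \<open>The coset construction\<close>

text \<open>
  An orbit \<open>i\<close> is an element of \<open>\<O> = orbits G (carrier A) \<Theta>\<close>, so \<open>a\<close>, \<open>J\<close> and \<open>K\<close> are functions of
  the orbit itself; \<open>a\<close> is constrained on all of \<open>\<O>\<close>, \<open>J\<close> and \<open>K\<close> only on \<open>I\<close>.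
\<close>

locale brace_coset_data = skew_left_brace A M
  for A :: "'b monoid" and M :: "'b monoid" +
  fixes a :: "'b set \<Rightarrow> 'b"
    and I :: "'b set set"
    and J :: "'b set \<Rightarrow> 'j set"
    and K :: "'b set \<Rightarrow> 'j \<Rightarrow> ('b \<times> 'b) set"
  assumes orbit_rep:
      "i \<in> orbits (brace_semidirect A M) (carrier A) (brace_Theta A M) \<Longrightarrow> a i \<in> i"
    and I_orbits: "I \<subseteq> orbits (brace_semidirect A M) (carrier A) (brace_Theta A M)"
    and I_nonempty: "I \<noteq> {}"
    and I_generates: "generate A (\<Union>I) = carrier A"
    and J_nonempty: "i \<in> I \<Longrightarrow> J i \<noteq> {}"
    and K_subgroup: "\<lbrakk>i \<in> I; j \<in> J i\<rbrakk> \<Longrightarrow> subgroup (K i j) (brace_semidirect A M)"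
    and K_stabilizer: "\<lbrakk>i \<in> I; j \<in> J i\<rbrakk> \<Longrightarrow>
      K i j \<subseteq> stabilizer (brace_semidirect A M) (brace_Theta A M) (a i)"
    and core_trivial:
      "{b \<in> carrier A.
          {(\<one>\<^bsub>A\<^esub>, b), (b, b)} \<subseteq> (\<Inter>i\<in>I. \<Inter>j\<in>J i. normal_core (brace_semidirect A M) (K i j))}
       = {\<one>\<^bsub>A\<^esub>}"

locale square_free_brace_coset_data = brace_coset_data A M a I J K
  for A :: "'b monoid" and M :: "'b monoid"
    and a :: "'b set \<Rightarrow> 'b" and I :: "'b set set"
    and J :: "'b set \<Rightarrow> 'j set" and K :: "'b set \<Rightarrow> 'j \<Rightarrow> ('b \<times> 'b) set" +
  assumes one_conj: "\<lbrakk>b \<in> carrier A; c \<in> carrier A; i \<in> I; j \<in> J i\<rbrakk> \<Longrightarrow>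
      (\<one>\<^bsub>A\<^esub>, brace_Theta A M (b, c) (a i)) \<in> conjugate_set (brace_semidirect A M) (b, c) (K i j)"
    and diag_conj: "\<lbrakk>b \<in> carrier A; c \<in> carrier A; i \<in> I; j \<in> J i\<rbrakk> \<Longrightarrow>
      (brace_Theta A M (b, c) (a i), brace_Theta A M (b, c) (a i))
        \<in> conjugate_set (brace_semidirect A M) (b, c) (K i j)"

text \<open>The disjoint union consists of triples \<open>(i, j, C)\<close> with \<open>C\<close> a left coset of \<open>K i j\<close>.\<close>

definition coset_carrier ::
  "'b monoid \<Rightarrow> 'b monoid \<Rightarrow> 'b set set \<Rightarrow> ('b set \<Rightarrow> 'j set) \<Rightarrow>
   ('b set \<Rightarrow> 'j \<Rightarrow> ('b \<times> 'b) set) \<Rightarrow> ('b set \<times> 'j \<times> ('b \<times> 'b) set) set" where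
  "coset_carrier A M I J K = (SIGMA i:I. SIGMA j:J i. lcosets\<^bsub>brace_semidirect A M\<^esub> (K i j))"

text \<open>
  The element $\Theta_{(b,c)}(a_i)$ attached to $x = (b,c)K_{i,j}$. It does not depend on the
  representative $(b,c)$ because $K_{i,j}$ stabilizes $a_i$, which is what the definite description
  relies on.
\<close>

definition coset_label ::
  "'b monoid \<Rightarrow> 'b monoid \<Rightarrow> ('b set \<Rightarrow> 'b) \<Rightarrow> 'b set \<times> 'j \<times> ('b \<times> 'b) set \<Rightarrow> 'b" where
  "coset_label A M a = (\<lambda>(i, j, C). THE u. \<exists>g\<in>C. u = brace_Theta A M g (a i))"

text \<open>
  Left translation \<open>g <#\<^bsub>G\<^esub> C\<close> of a coset \<open>C = (b, c)K\<close> is the coset $g(b,c)K$; below,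
  \<open>brace_Theta A M (\<one>, u) (coset_label A M a y)\<close> is $w = \Theta_{(1,u)}\Theta_{(b_2,c_2)}(a_{i_2})$.
\<close>

definition coset_map ::
  "'b monoid \<Rightarrow> 'b monoid \<Rightarrow> ('b set \<Rightarrow> 'b) \<Rightarrow>
   ('b set \<times> 'j \<times> ('b \<times> 'b) set) \<times> ('b set \<times> 'j \<times> ('b \<times> 'b) set) \<Rightarrow>
   ('b set \<times> 'j \<times> ('b \<times> 'b) set) \<times> ('b set \<times> 'j \<times> ('b \<times> 'b) set)" where
  "coset_map A M a = (\<lambda>(x, y).
     let G = brace_semidirect A M;
         u = coset_label A M a x;
         w = brace_Theta A M (\<one>\<^bsub>A\<^esub>, u) (coset_label A M a y);
         (i1, j1, C1) = x;
         (i2, j2, C2) = y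
     in ((i2, j2, (\<one>\<^bsub>A\<^esub>, u) <#\<^bsub>G\<^esub> C2), (i1, j1, inv\<^bsub>G\<^esub> (w, w) <#\<^bsub>G\<^esub> C1)))"

text \<open>
  On the choice of types when a solution on a set of elements of type \<open>'x\<close> is obtained from this
  construction: \<open>core_trivial\<close> says that sending \<open>b\<close> to the pair of permutations of the coset
  space induced by \<open>(\<one>, b)\<close> and \<open>(b, b)\<close> is injective. Hence a brace producing a solution
  isomorphic to the given one can always be carried by the type \<open>('x \<Rightarrow> 'x) \<times> ('x \<Rightarrow> 'x)\<close>, and the
  sets \<open>J i\<close> can be indexed by \<open>'x\<close>, so fixing these types loses no generality.
\<close>

end

theory Submission
  imports Defs
begin

text \<open>
  Both halves pass through one notion: an action of the semidirect product \<open>G = (B, \<star>) \<rtimes> (B, \<cdot>)\<close> on a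
  set \<open>X\<close> together with an equivariant labelling \<open>lab: X \<rightarrow> B\<close> such that \<open>(1, lab x)\<close> and
  \<open>(lab x, lab x)\<close> fix \<open>x\<close>. The coset space with the labels \<open>\<Theta>\<^sub>g(a\<^sub>i)\<close> of the cosets \<open>gK\<close> is of this
  kind: elements of \<open>gKg\<inverse>\<close> fix the coset \<open>gK\<close>, so the two membership conditions say exactly that
  the two elements of \<open>G\<close> attached to a coset fix it (\<open>labelled_coset_action\<close>).

  A labelled action gives a solution for the following reason. With \<open>p = lab x\<close>, \<open>q = lab y\<close>, \<open>w = lab (f\<^sub>x y)\<close> and
  \<open>v = lab (g\<^sub>y x)\<close> one has \<open>p \<cdot> q = w \<cdot> v\<close> (\<open>lab_mult\<close>). Both \<open>b \<mapsto> (1, b)\<close> and \<open>b \<mapsto> (b, b)\<close> are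
  morphisms from \<open>(B, \<cdot>)\<close> to \<open>G\<close>, so this identity gives the outer components of the braid equation,
  and the middle one comes from an identity in \<open>G\<close>. Since diagonal elements of labels fix their
  points, \<open>(w, w)\<inverse> x\<close> equals \<open>(q, q)\<inverse> x\<close>, so that \<open>g\<^sub>y\<close> is the action of one fixed group element
  (\<open>right_eq\<close>) and hence bijective.

  Conversely, a square-free solution is itself a labelled action. The Yang-Baxter equation on \<open>(x, x, y)\<close> gives
  \<open>g\<^bsub>f\<^sub>x y\<^esub> x = g\<^sub>y x\<close> (\<open>rg_lf_self\<close>). Let \<open>h\<^sub>y = g\<^sub>y\<inverse>\<close>, and let \<open>B\<close> be the group
  of pairs of permutations generated by the pairs \<open>(f\<^sub>x, h\<^sub>x)\<close>; this is \<open>(B, \<cdot>)\<close>. In the expected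
  second group, multiplying \<open>b\<close> on the right by the generator of \<open>x\<close> must be the map
  \<open>R\<^sub>x: b \<mapsto> b \<cdot> gen (f\<^sub>b\<inverse> x)\<close>, and multiplying on the left must be
  \<open>L\<^sub>x: b \<mapsto> R\<^bsub>\<sigma>\<^sub>b\<inverse> x\<^esub> b\<close> with \<open>\<sigma>\<^sub>b = h\<^sub>b f\<^sub>b\<inverse>\<close>. These maps are
  permutations of \<open>B\<close>, all \<open>L\<^sub>x\<close> commute with all \<open>R\<^sub>y\<close>, and both families generate from the identity
  all of \<open>B\<close>. So for each \<open>c\<close> exactly one permutation that commutes with every \<open>L\<^sub>x\<close> sends the identity to \<open>c\<close>,
  and applying it to \<open>b\<close> defines \<open>b \<star> c\<close> (\<open>commuting_translations\<close>). Left
  multiplication in \<open>(B, \<cdot>)\<close> permutes the \<open>L\<^sub>x\<close>, and this yields the brace axiom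
  (\<open>semilinear_map\<close>). Finally \<open>(a, b)\<close> acts on \<open>X\<close> by \<open>\<sigma>\<^sub>a f\<^sub>b\<close>, with the generators as labels.

  It remains to describe a labelled action by coset data. Each \<open>G\<close>-orbit in \<open>X\<close> contains a point whose label is the
  chosen representative of the orbit of labels; these points index the cosets, their stabilizers are
  the subgroups \<open>K\<^sub>i\<^sub>j\<close>, and \<open>X\<close> is the disjoint union of the coset spaces of these stabilizers. The
  core condition then says that only the identity of \<open>B\<close> acts trivially through both \<open>(1, b)\<close> and
  \<open>(b, b)\<close>, which holds because \<open>b\<close> is the pair of permutations by which these two elements act.
\<close>

section \<open>The semidirect product of a skew left brace and its action\<close>

context skew_left_brace
begin

abbreviation lam :: "'b \<Rightarrow> 'b \<Rightarrow> 'b" where "lam \<equiv> brace_lambda A M"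
abbreviation G :: "('b \<times> 'b) monoid" where "G \<equiv> brace_semidirect A M"
abbreviation Theta :: "'b \<times> 'b \<Rightarrow> 'b \<Rightarrow> 'b" where "Theta \<equiv> brace_Theta A M"

lemma mul_closed [simp]: "a \<in> carrier A \<Longrightarrow> b \<in> carrier A \<Longrightarrow> a \<otimes>\<^bsub>M\<^esub> b \<in> carrier A"
  and mul_inv_closed [simp]: "a \<in> carrier A \<Longrightarrow> inv\<^bsub>M\<^esub> a \<in> carrier A"
  using mul.m_closed mul.inv_closed by (simp_all add: carrier_eq)

lemma mul_assoc: "a \<in> carrier A \<Longrightarrow> b \<in> carrier A \<Longrightarrow> c \<in> carrier A
  \<Longrightarrow> a \<otimes>\<^bsub>M\<^esub> b \<otimes>\<^bsub>M\<^esub> c = a \<otimes>\<^bsub>M\<^esub> (b \<otimes>\<^bsub>M\<^esub> c)"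
  using mul.m_assoc by (simp add: carrier_eq)

lemma one_eq: "\<one>\<^bsub>M\<^esub> = \<one>\<^bsub>A\<^esub>"
proof -
  have e: "\<one>\<^bsub>M\<^esub> \<in> carrier A" using mul.one_closed by (simp add: carrier_eq)
  have "\<one>\<^bsub>M\<^esub> \<otimes>\<^bsub>M\<^esub> x = x" if "x \<in> carrier A" for x using that by (simp add: carrier_eq)
  then have "\<one>\<^bsub>A\<^esub> = inv\<^bsub>A\<^esub> \<one>\<^bsub>M\<^esub>"
    using compat[OF e add.one_closed add.one_closed] e by simp
  then show ?thesis using e by (metis add.inv_inv add.inv_one)
qed

lemma mul_one [simp]: "a \<in> carrier A \<Longrightarrow> \<one>\<^bsub>A\<^esub> \<otimes>\<^bsub>M\<^esub> a = a"
  and mul_one_right [simp]: "a \<in> carrier A \<Longrightarrow> a \<otimes>\<^bsub>M\<^esub> \<one>\<^bsub>A\<^esub> = a"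
  and mul_inv [simp]: "a \<in> carrier A \<Longrightarrow> inv\<^bsub>M\<^esub> a \<otimes>\<^bsub>M\<^esub> a = \<one>\<^bsub>A\<^esub>"
  and mul_inv_right [simp]: "a \<in> carrier A \<Longrightarrow> a \<otimes>\<^bsub>M\<^esub> inv\<^bsub>M\<^esub> a = \<one>\<^bsub>A\<^esub>"
  using mul.l_one mul.r_one mul.l_inv mul.r_inv by (simp_all add: carrier_eq one_eq)

lemma lam_closed [simp]: "a \<in> carrier A \<Longrightarrow> b \<in> carrier A \<Longrightarrow> lam a b \<in> carrier A"
  by (simp add: brace_lambda_def)

lemma mul_eq_add_lam: "a \<in> carrier A \<Longrightarrow> b \<in> carrier A \<Longrightarrow> a \<otimes>\<^bsub>M\<^esub> b = a \<otimes>\<^bsub>A\<^esub> lam a b"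
  by (simp add: brace_lambda_def add.m_assoc[symmetric])

lemma lam_add:
  assumes "a \<in> carrier A" "b \<in> carrier A" "c \<in> carrier A"
  shows "lam a (b \<otimes>\<^bsub>A\<^esub> c) = lam a b \<otimes>\<^bsub>A\<^esub> lam a c"
  using assms by (simp add: brace_lambda_def compat add.m_assoc)

lemma lam_one [simp]: "a \<in> carrier A \<Longrightarrow> lam a \<one>\<^bsub>A\<^esub> = \<one>\<^bsub>A\<^esub>"
  by (simp add: brace_lambda_def)

lemma lam_id [simp]: "a \<in> carrier A \<Longrightarrow> lam \<one>\<^bsub>A\<^esub> a = a"
  by (simp add: brace_lambda_def)

lemma lam_inv:
  assumes "a \<in> carrier A" "b \<in> carrier A"
  shows "lam a (inv\<^bsub>A\<^esub> b) = inv\<^bsub>A\<^esub> (lam a b)"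
proof -
  have "lam a (inv\<^bsub>A\<^esub> b) \<otimes>\<^bsub>A\<^esub> lam a b = \<one>\<^bsub>A\<^esub>"
    using assms by (simp add: lam_add[symmetric])
  then show ?thesis using assms by (simp add: add.inv_equality)
qed

text \<open>
  With \<open>lam_add\<close> this says that \<open>\<lambda>\<close> is a morphism from \<open>(B, \<cdot>)\<close> to the automorphisms of \<open>(B, \<star>)\<close>; it
  follows by expanding \<open>\<lambda>\<^sub>a(b\<^sup>\<star> \<star> (b \<cdot> c))\<close> with the additivity of \<open>\<lambda>\<^sub>a\<close>.
\<close>

lemma lam_mul:
  assumes "a \<in> carrier A" "b \<in> carrier A" "c \<in> carrier A"
  shows "lam (a \<otimes>\<^bsub>M\<^esub> b) c = lam a (lam b c)"
proof -
  have "lam a (lam b c) = inv\<^bsub>A\<^esub> (lam a b) \<otimes>\<^bsub>A\<^esub> lam a (b \<otimes>\<^bsub>M\<^esub> c)"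
    using assms by (simp add: brace_lambda_def[of A M b] lam_add lam_inv)
  also have "\<dots> = inv\<^bsub>A\<^esub> (a \<otimes>\<^bsub>M\<^esub> b) \<otimes>\<^bsub>A\<^esub> (a \<otimes>\<^bsub>A\<^esub> (inv\<^bsub>A\<^esub> a \<otimes>\<^bsub>A\<^esub> (a \<otimes>\<^bsub>M\<^esub> (b \<otimes>\<^bsub>M\<^esub> c))))"
    using assms by (simp add: brace_lambda_def add.inv_mult_group add.m_assoc)
  also have "\<dots> = lam (a \<otimes>\<^bsub>M\<^esub> b) c"
    using assms by (simp add: brace_lambda_def mul_assoc add.m_assoc[symmetric])
  finally show ?thesis by simp
qed

lemma carrier_G [simp]: "carrier G = carrier A \<times> carrier A"
  by (simp add: brace_semidirect_def carrier_eq)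

lemma mult_G [simp]: "(a, b) \<otimes>\<^bsub>G\<^esub> (c, d) = (a \<otimes>\<^bsub>A\<^esub> lam b c, b \<otimes>\<^bsub>M\<^esub> d)"
  by (simp add: brace_semidirect_def)

lemma one_G [simp]: "\<one>\<^bsub>G\<^esub> = (\<one>\<^bsub>A\<^esub>, \<one>\<^bsub>A\<^esub>)"
  by (simp add: brace_semidirect_def one_eq)

lemma group_G: "group G"
proof (rule groupI)
  fix x assume "x \<in> carrier G"
  then obtain a b where x: "x = (a, b)" and [simp]: "a \<in> carrier A" "b \<in> carrier A" by auto
  have "(lam (inv\<^bsub>M\<^esub> b) (inv\<^bsub>A\<^esub> a), inv\<^bsub>M\<^esub> b) \<otimes>\<^bsub>G\<^esub> x = \<one>\<^bsub>G\<^esub>"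
    by (simp add: x lam_add[symmetric])
  then show "\<exists>y\<in>carrier G. y \<otimes>\<^bsub>G\<^esub> x = \<one>\<^bsub>G\<^esub>" by force
qed (auto simp: lam_add lam_mul add.m_assoc mul_assoc)

sublocale G: group G by (rule group_G)

lemma Theta_closed [simp]: "g \<in> carrier G \<Longrightarrow> c \<in> carrier A \<Longrightarrow> Theta g c \<in> carrier A"
  by (auto simp: brace_Theta_def)

lemma Theta_mult:
  "g \<in> carrier G \<Longrightarrow> h \<in> carrier G \<Longrightarrow> c \<in> carrier A \<Longrightarrow> Theta (g \<otimes>\<^bsub>G\<^esub> h) c = Theta g (Theta h c)"
  by (auto simp: brace_Theta_def lam_add lam_mul lam_inv add.m_assoc add.inv_mult_group)

lemma Theta_one [simp]: "c \<in> carrier A \<Longrightarrow> Theta (\<one>\<^bsub>A\<^esub>, \<one>\<^bsub>A\<^esub>) c = c"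
  by (simp add: brace_Theta_def)

lemma Theta_lam [simp]: "b \<in> carrier A \<Longrightarrow> c \<in> carrier A \<Longrightarrow> Theta (\<one>\<^bsub>A\<^esub>, b) c = lam b c"
  by (simp add: brace_Theta_def)

text \<open>
  The diagonal is a second copy of \<open>(B, \<cdot>)\<close> in \<open>G\<close>, besides \<open>{1} \<times> B\<close>, because \<open>b \<star> \<lambda>\<^sub>b(c) = b \<cdot> c\<close>.
\<close>

lemma diag_mult: "b \<in> carrier A \<Longrightarrow> c \<in> carrier A \<Longrightarrow> (b, b) \<otimes>\<^bsub>G\<^esub> (c, c) = (b \<otimes>\<^bsub>M\<^esub> c, b \<otimes>\<^bsub>M\<^esub> c)"
  by (simp add: mul_eq_add_lam)

end

section \<open>Solutions from labelled actions\<close>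

locale labelled_brace_action = skew_left_brace A M for A M :: "'b monoid" +
  fixes X :: "'x set" and act :: "'b \<times> 'b \<Rightarrow> 'x \<Rightarrow> 'x" and lab :: "'x \<Rightarrow> 'b"
  assumes X_nonempty: "X \<noteq> {}"
    and act_closed [simp]: "g \<in> carrier G \<Longrightarrow> x \<in> X \<Longrightarrow> act g x \<in> X"
    and act_one [simp]: "x \<in> X \<Longrightarrow> act (\<one>\<^bsub>A\<^esub>, \<one>\<^bsub>A\<^esub>) x = x"
    and act_mult: "g \<in> carrier G \<Longrightarrow> h \<in> carrier G \<Longrightarrow> x \<in> X
      \<Longrightarrow> act (g \<otimes>\<^bsub>G\<^esub> h) x = act g (act h x)"
    and lab_closed [simp]: "x \<in> X \<Longrightarrow> lab x \<in> carrier A"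
    and lab_act: "g \<in> carrier G \<Longrightarrow> x \<in> X \<Longrightarrow> lab (act g x) = Theta g (lab x)"
    and lab_fixes: "x \<in> X \<Longrightarrow> act (\<one>\<^bsub>A\<^esub>, lab x) x = x"
    and diag_lab_fixes: "x \<in> X \<Longrightarrow> act (lab x, lab x) x = x"
begin

abbreviation dg :: "'b \<Rightarrow> 'x \<Rightarrow> 'x" where "dg b \<equiv> act (b, b)"
abbreviation left :: "'x \<Rightarrow> 'x \<Rightarrow> 'x" where "left x \<equiv> act (\<one>\<^bsub>A\<^esub>, lab x)"

text \<open>
  The second component of the solution is defined through \<open>w = lab (left x y)\<close>; that it is this map,
  which uses \<open>lab y\<close> in place of \<open>w\<close>, is \<open>right_eq\<close> below.
\<close>

definition right :: "'x \<Rightarrow> 'x \<Rightarrow> 'x" where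
  "right y x = act (inv\<^bsub>G\<^esub> (lab y, lab y)) x"

lemma act_inv_act [simp]: "h \<in> carrier G \<Longrightarrow> x \<in> X \<Longrightarrow> act (inv\<^bsub>G\<^esub> h) (act h x) = x"
  and act_act_inv [simp]: "h \<in> carrier G \<Longrightarrow> x \<in> X \<Longrightarrow> act h (act (inv\<^bsub>G\<^esub> h) x) = x"
  by (simp_all add: act_mult[symmetric] del: carrier_G)

lemma dg_inv:
  assumes "b \<in> carrier A" "x \<in> X" shows "act (inv\<^bsub>G\<^esub> (b, b)) (dg b x) = x"
    and "dg b (act (inv\<^bsub>G\<^esub> (b, b)) x) = x"
  using assms by auto

lemma act_diag_inv_closed [simp]:
  "b \<in> carrier A \<Longrightarrow> x \<in> X \<Longrightarrow> act (inv\<^bsub>G\<^esub> (b, b)) x \<in> X"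
  by (rule act_closed[OF G.inv_closed]) auto

lemma act_inv_eq_iff:
  assumes "h \<in> carrier G" "x \<in> X" "y \<in> X"
  shows "act (inv\<^bsub>G\<^esub> h) x = y \<longleftrightarrow> x = act h y"
  using assms by auto

lemma act_bij: "h \<in> carrier G \<Longrightarrow> bij_betw (act h) X X"
  by (rule bij_betw_byWitness[where f' = "act (inv\<^bsub>G\<^esub> h)"]) (auto simp del: carrier_G)

lemma left_closed: "x \<in> X \<Longrightarrow> y \<in> X \<Longrightarrow> left x y \<in> X"
  and right_closed: "x \<in> X \<Longrightarrow> y \<in> X \<Longrightarrow> right y x \<in> X"
  unfolding right_def by simp_all

lemma lab_left: "x \<in> X \<Longrightarrow> y \<in> X \<Longrightarrow> lab (left x y) = lam (lab x) (lab y)"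
  by (simp add: lab_act)

lemma Theta_diag:
  assumes "b \<in> carrier A" "c \<in> carrier A"
  shows "Theta (b, b) c \<otimes>\<^bsub>A\<^esub> b = b \<otimes>\<^bsub>M\<^esub> c"
  using assms by (simp add: brace_Theta_def mul_eq_add_lam add.m_assoc)

text \<open>
  Write \<open>p\<close>, \<open>q\<close>, \<open>w\<close> for the labels of \<open>x\<close>, \<open>y\<close>, \<open>left x y\<close>. Then \<open>p \<cdot> q = p \<star> \<lambda>\<^sub>p(q) = p \<star> w\<close>, and \<open>z\<close> is
  chosen so that \<open>p = \<Theta>\<^bsub>(w,w)\<^esub>(lab z)\<close>, that is, \<open>p \<star> w = w \<cdot> lab z\<close>.
\<close>

lemma lab_factor:
  assumes "x \<in> X" "y \<in> X" and z: "z = act (inv\<^bsub>G\<^esub> (lab (left x y), lab (left x y))) x"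
  shows "lab x \<otimes>\<^bsub>M\<^esub> lab y = lab (left x y) \<otimes>\<^bsub>M\<^esub> lab z"
proof -
  let ?w = "lab (left x y)"
  have w: "?w \<in> carrier A" and zX: "z \<in> X" using assms by auto
  have "x = dg ?w z" using assms w by (simp add: dg_inv)
  then have "lab x = Theta (?w, ?w) (lab z)" using lab_act[of "(?w, ?w)" z] w zX by simp
  then have "lab x \<otimes>\<^bsub>A\<^esub> ?w = ?w \<otimes>\<^bsub>M\<^esub> lab z"
    using Theta_diag[OF w lab_closed[OF zX]] by metis
  moreover have "lab x \<otimes>\<^bsub>A\<^esub> ?w = lab x \<otimes>\<^bsub>M\<^esub> lab y"
    using assms by (simp add: lab_left mul_eq_add_lam)
  ultimately show ?thesis by simp
qed

text \<open>
  By \<open>lab_factor\<close>, the diagonal elements satisfy \<open>(p, p)(q, q) = (w, w)(v, v)\<close> with \<open>v = lab z\<close>. As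
  \<open>(p, p)\<close> fixes \<open>x\<close> and \<open>(v, v)\<close> fixes \<open>z\<close>, the relation \<open>x = (w, w) z\<close> becomes \<open>x = (q, q) z\<close>.
\<close>

lemma right_eq:
  assumes "x \<in> X" "y \<in> X"
  shows "act (inv\<^bsub>G\<^esub> (lab (left x y), lab (left x y))) x = right y x"
proof -
  let ?w = "lab (left x y)"
  define z where "z = act (inv\<^bsub>G\<^esub> (?w, ?w)) x"
  have [simp]: "?w \<in> carrier A" "z \<in> X" "lab x \<in> carrier A" "lab y \<in> carrier A" "lab z \<in> carrier A"
    using assms by (auto simp: z_def)
  have gX: "right y x \<in> X" using assms right_closed by simp
  have "dg (lab x) (dg (lab y) (right y x)) = dg (lab x) x"
    using assms by (simp add: right_def dg_inv)
  also have "\<dots> = dg ?w z" using assms by (simp add: diag_lab_fixes z_def dg_inv)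
  also have "\<dots> = dg ?w (dg (lab z) z)" by (simp add: diag_lab_fixes)
  also have "\<dots> = dg (lab x) (dg (lab y) z)"
    using lab_factor[OF assms z_def] assms
    by (simp add: act_mult[symmetric] diag_mult del: mult_G)
  finally show ?thesis
    using assms gX by (metis (no_types) dg_inv(1) act_closed carrier_G lab_closed mem_Sigma_iff z_def \<open>z \<in> X\<close>)
qed

lemma lab_mult:
  assumes "x \<in> X" "y \<in> X"
  shows "lab x \<otimes>\<^bsub>M\<^esub> lab y = lab (left x y) \<otimes>\<^bsub>M\<^esub> lab (right y x)"
  using lab_factor[OF assms refl] right_eq[OF assms] by simp

lemma left_left:
  assumes "x \<in> X" "y \<in> X" "z \<in> X"
  shows "left x (left y z) = left (left x y) (left (right y x) z)"
  using assms left_closed[of x y] right_closed[of x y] lab_mult[of x y]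
  by (simp add: act_mult[symmetric] del: lab_left)

lemma right_right:
  assumes "x \<in> X" "y \<in> X" "z \<in> X"
  shows "right z (right y x) = right (right z y) (right (left y z) x)"
proof -
  have [simp]: "left y z \<in> X" "right z y \<in> X" using assms left_closed right_closed by auto
  have inv2: "right c (right b x) = act (inv\<^bsub>G\<^esub> (lab b \<otimes>\<^bsub>M\<^esub> lab c, lab b \<otimes>\<^bsub>M\<^esub> lab c)) x"
    if "b \<in> X" "c \<in> X" for b c
  proof -
    have "(lab b \<otimes>\<^bsub>M\<^esub> lab c, lab b \<otimes>\<^bsub>M\<^esub> lab c) = (lab b, lab b) \<otimes>\<^bsub>G\<^esub> (lab c, lab c)"
      using that by (simp add: diag_mult del: mult_G)
    then show ?thesis
      using that assms
      by (simp add: right_def G.inv_mult_group act_mult[OF G.inv_closed G.inv_closed] del: mult_G)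
  qed
  show ?thesis using assms lab_mult[of y z] by (simp add: inv2)
qed

text \<open>
  Both sides are the image of \<open>y\<close> under an element of \<open>G\<close>. With \<open>s = lab (left y z)\<close>, \<open>W = \<lambda>\<^sub>p(s)\<close> and
  \<open>p \<cdot> s = W \<cdot> V\<close>, the equality of the two elements is \<open>(W, W)(1, V) = (W, p \<cdot> s) = (1, p)(s, s)\<close>.
\<close>

lemma right_left:
  assumes x: "x \<in> X" and y: "y \<in> X" and z: "z \<in> X"
  shows "right (left (right y x) z) (left x y) = left (right (left y z) x) (right z y)"
proof -
  note [simp] = x y z
  have [simp]: "left y z \<in> X" "left x y \<in> X" "right y x \<in> X" "left x (left y z) \<in> X" "right (left y z) x \<in> X"
    "left (right y x) z \<in> X"
    using left_closed right_closed by auto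
  let ?p = "lab x" and ?s = "lab (left y z)"
  let ?W = "lab (left x (left y z))" and ?V = "lab (right (left y z) x)"
  have c [simp]: "?p \<in> carrier A" "?s \<in> carrier A" "?W \<in> carrier A" "?V \<in> carrier A"
    by (simp_all del: lab_left)
  have lhs: "right (left (right y x) z) (left x y) = act (inv\<^bsub>G\<^esub> (?W, ?W)) (left x y)"
    using right_eq[of "left x y" "left (right y x) z"] left_left[of x y z] by simp
  have rhs: "right z y = act (inv\<^bsub>G\<^esub> (?s, ?s)) y" using right_eq[of y z] by simp
  have "(?W, ?W) \<otimes>\<^bsub>G\<^esub> (\<one>\<^bsub>A\<^esub>, ?V) = (\<one>\<^bsub>A\<^esub>, ?p) \<otimes>\<^bsub>G\<^esub> (?s, ?s)"
    using lab_mult[of x "left y z"] lab_left[of x "left y z"] by simp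
  then have "dg ?W (left (right (left y z) x) v) = left x (dg ?s v)" if "v \<in> X" for v
    using that by (metis act_mult c carrier_G mem_Sigma_iff add.one_closed)
  then have "dg ?W (left (right (left y z) x) (right z y)) = left x y"
    using right_closed[of y z] by (simp add: rhs dg_inv)
  then show ?thesis
    unfolding lhs using left_closed[of "right (left y z) x" "right z y"] right_closed[of y z]
    by (subst act_inv_eq_iff) auto
qed

lemma right_self: "x \<in> X \<Longrightarrow> right x x = x"
  using dg_inv(1)[of "lab x" x] by (simp add: right_def diag_lab_fixes)

proposition square_free_solution_of_action:
  assumes r: "\<And>x y. x \<in> X \<Longrightarrow> y \<in> X \<Longrightarrow>
    r (x, y) = (act (\<one>\<^bsub>A\<^esub>, lab x) y,
                act (inv\<^bsub>G\<^esub> (lab (act (\<one>\<^bsub>A\<^esub>, lab x) y), lab (act (\<one>\<^bsub>A\<^esub>, lab x) y))) x)"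
  shows "square_free_solution X r"
proof -
  have r': "r (x, y) = (left x y, right y x)" if "x \<in> X" "y \<in> X" for x y
    using that by (simp add: r right_eq)
  have fb: "bij_betw (left x) X X" and gb: "bij_betw (right x) X X" if "x \<in> X" for x
    using act_bij[of "(\<one>\<^bsub>A\<^esub>, lab x)"] act_bij[OF G.inv_closed, of "(lab x, lab x)"] that
    unfolding right_def by simp_all
  have "bij_betw r (X \<times> X) (X \<times> X)"
  proof (rule bij_betwI')
    fix t assume "t \<in> X \<times> X"
    then obtain x y where t: "t = (x, y)" and [simp]: "x \<in> X" "y \<in> X" by auto
    show "r t \<in> X \<times> X" by (simp add: t r' right_closed)
    fix t' assume "t' \<in> X \<times> X"
    then obtain x' y' where t': "t' = (x', y')" and [simp]: "x' \<in> X" "y' \<in> X" by auto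
    show "(r t = r t') = (t = t')"
    proof
      assume eq: "r t = r t'"
      then have "left x y = left x' y' \<and> act (inv\<^bsub>G\<^esub> (lab (left x y), lab (left x y))) x
          = act (inv\<^bsub>G\<^esub> (lab (left x' y'), lab (left x' y'))) x'"
        unfolding t t' r[OF \<open>x \<in> X\<close> \<open>y \<in> X\<close>] r[OF \<open>x' \<in> X\<close> \<open>y' \<in> X\<close>] prod.inject .
      note 1 = this[THEN conjunct1] and 2 = this[THEN conjunct2]
      have "x = x'"
      proof -
        have "x = dg (lab (left x' y')) (act (inv\<^bsub>G\<^esub> (lab (left x' y'), lab (left x' y'))) x)"
          by (rule dg_inv(2)[symmetric]) simp_all
        also have "\<dots> = dg (lab (left x' y')) (act (inv\<^bsub>G\<^esub> (lab (left x' y'), lab (left x' y'))) x')"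
          by (simp only: 2[unfolded 1])
        also have "\<dots> = x'" by (rule dg_inv(2)) simp_all
        finally show ?thesis .
      qed
      moreover have "y = y'"
        using 1 fb[of x] \<open>x = x'\<close> by (auto simp: bij_betw_def inj_on_def)
      ultimately show "t = t'" by (simp add: t t')
    qed simp
  next
    fix t assume "t \<in> X \<times> X"
    then obtain a b where t: "t = (a, b)" and [simp]: "a \<in> X" "b \<in> X" by auto
    \<comment> \<open>the second component is \<open>b = (lab a, lab a)\<inverse> x\<close>, since \<open>a = left x y\<close>; this gives \<open>x\<close>, and then \<open>a\<close> gives \<open>y\<close>\<close>
    define x where "x = dg (lab a) b"
    define y where "y = act (inv\<^bsub>G\<^esub> (\<one>\<^bsub>A\<^esub>, lab x)) a"
    have [simp]: "x \<in> X" by (simp add: x_def)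
    have [simp]: "y \<in> X" unfolding y_def by (rule act_closed[OF G.inv_closed]) auto
    have fxy: "left x y = a" unfolding y_def by (rule act_act_inv) (simp_all add: x_def)
    have "act (inv\<^bsub>G\<^esub> (lab a, lab a)) x = b" unfolding x_def by (rule dg_inv(1)) simp_all
    then have "r (x, y) = t" using r[of x y] unfolding fxy t by simp
    then show "\<exists>s\<in>X \<times> X. t = r s" by (intro bexI[of _ "(x, y)"]) simp_all
  qed
  moreover have "\<forall>t \<in> X \<times> X \<times> X. yb_r1 r (yb_r2 r (yb_r1 r t)) = yb_r2 r (yb_r1 r (yb_r2 r t))"
  proof
    fix t assume "t \<in> X \<times> X \<times> X"
    then obtain x y z where t: "t = (x, y, z)" and [simp]: "x \<in> X" "y \<in> X" "z \<in> X"
      by auto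
    show "yb_r1 r (yb_r2 r (yb_r1 r t)) = yb_r2 r (yb_r1 r (yb_r2 r t))"
      unfolding t yb_r1_def yb_r2_def
      by (simp add: r' left_closed right_closed left_left[of x y z, symmetric] right_left right_right[of x y z])
  qed
  moreover have "\<forall>x\<in>X. bij_betw (\<lambda>y. fst (r (x, y))) X X"
  proof
    fix x assume x: "x \<in> X"
    have "bij_betw (\<lambda>y. fst (r (x, y))) X X \<longleftrightarrow> bij_betw (left x) X X"
      by (rule bij_betw_cong) (simp add: r' x)
    then show "bij_betw (\<lambda>y. fst (r (x, y))) X X" using fb[OF x] by (rule iffD2)
  qed
  moreover have "\<forall>y\<in>X. bij_betw (\<lambda>x. snd (r (x, y))) X X"
  proof
    fix y assume y: "y \<in> X"
    have "bij_betw (\<lambda>x. snd (r (x, y))) X X \<longleftrightarrow> bij_betw (right y) X X"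
      by (rule bij_betw_cong) (simp add: r' y)
    then show "bij_betw (\<lambda>x. snd (r (x, y))) X X" using gb[OF y] by (rule iffD2)
  qed
  moreover have "\<forall>x\<in>X. r (x, x) = (x, x)"
    by (simp add: r' lab_fixes right_self)
  ultimately show ?thesis
    using X_nonempty by (simp add: square_free_solution_def nondegenerate_solution_def yb_solution_def)
qed

end

section \<open>The coset construction\<close>

lemma (in group) conjugate_set_fixes_coset:
  assumes "subgroup H G" "g \<in> carrier G" "k \<in> conjugate_set G g H"
  shows "k <# (g <# H) = g <# H"
proof -
  obtain t where t: "t \<in> H" "k = g \<otimes> t \<otimes> inv g"
    using assms(3) by (auto simp: conjugate_set_def l_coset_def r_coset_def)
  have [simp]: "t \<in> carrier G" "H \<subseteq> carrier G" using assms(1) t subgroup.subset by blast+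
  have "k <# (g <# H) = (g \<otimes> t) <# H"
    using assms t by (simp add: lcos_m_assoc m_assoc)
  also have "\<dots> = g <# H"
    using l_repr_independence[of "g \<otimes> t" g H] assms t by (auto simp: l_coset_def)
  finally show ?thesis .
qed

context square_free_brace_coset_data
begin

abbreviation coset_act :: "'b \<times> 'b \<Rightarrow> 'b set \<times> 'j \<times> ('b \<times> 'b) set \<Rightarrow> 'b set \<times> 'j \<times> ('b \<times> 'b) set"
  where "coset_act g \<equiv> (\<lambda>(i, j, C). (i, j, g <#\<^bsub>G\<^esub> C))"

lemma a_closed: "i \<in> I \<Longrightarrow> a i \<in> carrier A"
proof -
  assume "i \<in> I"
  then have i: "i \<in> orbits G (carrier A) Theta" using I_orbits by (rule rev_subsetD)
  then obtain c where "c \<in> carrier A" "i = orbit G Theta c" unfolding orbits_def by blast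
  then show ?thesis using orbit_rep[OF i] unfolding orbit_def by (auto simp del: carrier_G)
qed

lemma coset_carrierE:
  assumes "x \<in> coset_carrier A M I J K"
  obtains i j g where "x = (i, j, g <#\<^bsub>G\<^esub> K i j)" "i \<in> I" "j \<in> J i" "g \<in> carrier G"
  using assms by (auto simp: coset_carrier_def LCOSETS_def)

lemma K_subset: "i \<in> I \<Longrightarrow> j \<in> J i \<Longrightarrow> K i j \<subseteq> carrier G"
  using K_subgroup subgroup.subset by blast

text \<open>
  Every element of the coset has the form \<open>g s\<close> with \<open>s \<in> K i j\<close>, and \<open>s\<close> stabilizes \<open>a i\<close>; the definite
  description in \<open>coset_label\<close> therefore denotes the value at any representative.
\<close>

lemma coset_label_coset:
  assumes "i \<in> I" "j \<in> J i" "g \<in> carrier G"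
  shows "coset_label A M a (i, j, g <#\<^bsub>G\<^esub> K i j) = Theta g (a i)"
proof -
  have *: "Theta k (a i) = Theta g (a i)" if k: "k \<in> g <#\<^bsub>G\<^esub> K i j" for k
  proof -
    obtain s where s: "s \<in> K i j" "k = g \<otimes>\<^bsub>G\<^esub> s" using k unfolding l_coset_def by blast
    have "s \<in> carrier G" "Theta s (a i) = a i"
      using subsetD[OF K_stabilizer[OF assms(1,2)] s(1)] by (simp_all add: stabilizer_def)
    then show ?thesis using Theta_mult[OF assms(3), of s "a i"] a_closed[OF assms(1)] s(2) by simp
  qed
  have "g \<in> g <#\<^bsub>G\<^esub> K i j" by (rule G.lcos_self[OF assms(3) K_subgroup[OF assms(1,2)]])
  then have "(THE u. \<exists>k\<in>g <#\<^bsub>G\<^esub> K i j. u = Theta k (a i)) = Theta g (a i)"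
    using * by (intro the_equality) blast+
  then show ?thesis by (simp add: coset_label_def)
qed

lemma labelled_coset_action:
  "labelled_brace_action A M (coset_carrier A M I J K) coset_act (coset_label A M a)"
proof (unfold_locales, goal_cases)
  case 1
  obtain i where "i \<in> I" using I_nonempty by blast
  moreover obtain j where "j \<in> J i" using J_nonempty[OF \<open>i \<in> I\<close>] by blast
  ultimately have "(i, j, \<one>\<^bsub>G\<^esub> <#\<^bsub>G\<^esub> K i j) \<in> coset_carrier A M I J K"
    unfolding coset_carrier_def LCOSETS_def using G.one_closed by blast
  then show ?case by blast
next
  case (2 g x)
  then obtain i j k where x: "x = (i, j, k <#\<^bsub>G\<^esub> K i j)" "i \<in> I" "j \<in> J i" "k \<in> carrier G"
    by (elim coset_carrierE)
  then have "g <#\<^bsub>G\<^esub> (k <#\<^bsub>G\<^esub> K i j) = (g \<otimes>\<^bsub>G\<^esub> k) <#\<^bsub>G\<^esub> K i j" "g \<otimes>\<^bsub>G\<^esub> k \<in> carrier G"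
    using 2 G.lcos_m_assoc K_subset by auto
  then show ?case using x by (auto simp: coset_carrier_def LCOSETS_def simp del: carrier_G)
next
  case (3 x)
  then obtain i j k where x: "x = (i, j, k <#\<^bsub>G\<^esub> K i j)" "i \<in> I" "j \<in> J i" "k \<in> carrier G"
    by (elim coset_carrierE)
  then show ?case
    using G.lcos_mult_one[OF G.l_coset_subset_G[OF K_subset x(4)]] by simp
next
  case (4 g h x)
  then obtain i j k where x: "x = (i, j, k <#\<^bsub>G\<^esub> K i j)" "i \<in> I" "j \<in> J i" "k \<in> carrier G"
    by (elim coset_carrierE)
  then show ?case
    using G.lcos_m_assoc[OF G.l_coset_subset_G[OF K_subset x(4)]] 4 by simp
next
  case (5 x)
  then show ?case by (elim coset_carrierE) (simp only: coset_label_coset Theta_closed a_closed)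
next
  case (6 g x)
  then obtain i j k where x: "x = (i, j, k <#\<^bsub>G\<^esub> K i j)" "i \<in> I" "j \<in> J i" "k \<in> carrier G"
    by (elim coset_carrierE)
  then have "g <#\<^bsub>G\<^esub> (k <#\<^bsub>G\<^esub> K i j) = (g \<otimes>\<^bsub>G\<^esub> k) <#\<^bsub>G\<^esub> K i j" "g \<otimes>\<^bsub>G\<^esub> k \<in> carrier G"
    using 6 G.lcos_m_assoc K_subset by auto
  then show ?case using x 6 by (simp only: prod.case coset_label_coset Theta_mult a_closed)
next
  case (7 x)
  then obtain i j k where x: "x = (i, j, k <#\<^bsub>G\<^esub> K i j)" "i \<in> I" "j \<in> J i" "k \<in> carrier G"
    by (elim coset_carrierE)
  then show ?case
    using one_conj[of "fst k" "snd k" i j] G.conjugate_set_fixes_coset K_subgroup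
    by (auto simp only: coset_label_coset prod.case carrier_G mem_Times_iff prod.collapse)
next
  case (8 x)
  then obtain i j k where x: "x = (i, j, k <#\<^bsub>G\<^esub> K i j)" "i \<in> I" "j \<in> J i" "k \<in> carrier G"
    by (elim coset_carrierE)
  then show ?case
    using diag_conj[of "fst k" "snd k" i j] G.conjugate_set_fixes_coset K_subgroup
    by (auto simp only: coset_label_coset prod.case carrier_G mem_Times_iff prod.collapse)
qed

theorem square_free_coset_solution:
  "square_free_solution (coset_carrier A M I J K) (coset_map A M a)"
proof -
  interpret labelled_brace_action A M "coset_carrier A M I J K" coset_act "coset_label A M a"
    by (rule labelled_coset_action)
  show ?thesis
  proof (rule square_free_solution_of_action)
    fix x y assume x: "x \<in> coset_carrier A M I J K" and y: "y \<in> coset_carrier A M I J K"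
    have "Theta (\<one>\<^bsub>A\<^esub>, coset_label A M a x) (coset_label A M a y)
        = coset_label A M a (coset_act (\<one>\<^bsub>A\<^esub>, coset_label A M a x) y)"
      using x y by (simp only: lab_act carrier_G mem_Times_iff fst_conv snd_conv lab_closed add.one_closed)
    then show "coset_map A M a (x, y) =
      (coset_act (\<one>\<^bsub>A\<^esub>, coset_label A M a x) y,
       coset_act (inv\<^bsub>G\<^esub> (coset_label A M a (coset_act (\<one>\<^bsub>A\<^esub>, coset_label A M a x) y),
                        coset_label A M a (coset_act (\<one>\<^bsub>A\<^esub>, coset_label A M a x) y))) x)"
      by (simp add: coset_map_def Let_def split_def del: Theta_lam)
  qed
qed

end

section \<open>Coset data from a labelled action\<close>

lemma orbit_act:
  assumes "group H" and g: "g \<in> carrier H" and x: "x \<in> E"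
    and mult: "\<And>k l y. k \<in> carrier H \<Longrightarrow> l \<in> carrier H \<Longrightarrow> y \<in> E \<Longrightarrow> \<phi> (k \<otimes>\<^bsub>H\<^esub> l) y = \<phi> k (\<phi> l y)"
  shows "orbit H \<phi> (\<phi> g x) = orbit H \<phi> x"
proof -
  interpret H: group H by fact
  have "\<phi> k (\<phi> g x) \<in> orbit H \<phi> x" if "k \<in> carrier H" for k
    using mult[OF that g x] that g unfolding orbit_def
    by (intro CollectI exI[of _ "k \<otimes>\<^bsub>H\<^esub> g"]) simp
  moreover have "\<phi> k x \<in> orbit H \<phi> (\<phi> g x)" if "k \<in> carrier H" for k
    using mult[of "k \<otimes>\<^bsub>H\<^esub> inv\<^bsub>H\<^esub> g" g x] that g x unfolding orbit_def
    by (intro CollectI exI[of _ "k \<otimes>\<^bsub>H\<^esub> inv\<^bsub>H\<^esub> g"]) (simp add: H.m_assoc)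
  ultimately show ?thesis by (auto simp: orbit_def)
qed

context labelled_brace_action
begin

abbreviation lab_orbit :: "'x \<Rightarrow> 'b set" where "lab_orbit x \<equiv> orbit G Theta (lab x)"

abbreviation fibre :: "'x \<Rightarrow> 'x \<Rightarrow> ('b \<times> 'b) set" where
  "fibre y x \<equiv> {g \<in> carrier G. act g y = x}"

lemma lab_orbit_act: "g \<in> carrier G \<Longrightarrow> x \<in> X \<Longrightarrow> lab_orbit (act g x) = lab_orbit x"
  using orbit_act[OF group_G, of g "lab x" "carrier A" Theta] Theta_mult by (simp add: lab_act)

text \<open>
  For \<open>x = y\<close> this identifies the left cosets of the stabilizer of \<open>y\<close> with the points of its orbit.
\<close>

lemma translate_fibre:
  assumes "k \<in> carrier G" "y \<in> X" "x \<in> X"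
  shows "k <#\<^bsub>G\<^esub> fibre y x = fibre y (act k x)"
proof
  show "k <#\<^bsub>G\<^esub> fibre y x \<subseteq> fibre y (act k x)"
  proof
    fix t assume "t \<in> k <#\<^bsub>G\<^esub> fibre y x"
    then obtain g where g: "g \<in> carrier G" "act g y = x" "t = k \<otimes>\<^bsub>G\<^esub> g"
      unfolding l_coset_def by blast
    then show "t \<in> fibre y (act k x)"
      using act_mult[OF assms(1) g(1) assms(2)] G.m_closed[OF assms(1) g(1)] by (simp del: carrier_G)
  qed
  show "fibre y (act k x) \<subseteq> k <#\<^bsub>G\<^esub> fibre y x"
  proof
    fix g assume "g \<in> fibre y (act k x)"
    then have g: "g \<in> carrier G" "act g y = act k x" by (simp_all del: carrier_G)
    have "inv\<^bsub>G\<^esub> k \<otimes>\<^bsub>G\<^esub> g \<in> fibre y x"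
      using g assms act_mult[OF G.inv_closed[OF assms(1)] g(1) assms(2)]
        G.m_closed[OF G.inv_closed[OF assms(1)] g(1)] by (simp del: carrier_G)
    moreover have "g = k \<otimes>\<^bsub>G\<^esub> (inv\<^bsub>G\<^esub> k \<otimes>\<^bsub>G\<^esub> g)"
      using G.m_assoc[OF assms(1) G.inv_closed[OF assms(1)] g(1)] assms g
      by (simp only: G.r_inv G.l_one)
    ultimately show "g \<in> k <#\<^bsub>G\<^esub> fibre y x" unfolding l_coset_def by blast
  qed
qed

lemma stabilizer_eq_fibre: "stabilizer G act y = fibre y y"
  by (auto simp: stabilizer_def)

lemma subgroup_stabilizer:
  assumes "y \<in> X" shows "subgroup (stabilizer G act y) G"
proof (rule G.subgroupI)
  show "stabilizer G act y \<subseteq> carrier G" by (auto simp: stabilizer_def)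
  show "stabilizer G act y \<noteq> {}"
  proof -
    have "\<one>\<^bsub>G\<^esub> \<in> stabilizer G act y" using act_one[OF assms] by (simp add: stabilizer_def)
    then show ?thesis by blast
  qed
  fix g assume g: "g \<in> stabilizer G act y"
  then have gG: "g \<in> carrier G" and gy: "act g y = y" by (simp_all add: stabilizer_def)
  show "inv\<^bsub>G\<^esub> g \<in> stabilizer G act y"
    using act_inv_act[OF gG assms] G.inv_closed[OF gG] gy by (simp add: stabilizer_def del: carrier_G)
  fix k assume "k \<in> stabilizer G act y"
  then have kG: "k \<in> carrier G" and ky: "act k y = y" by (simp_all add: stabilizer_def)
  show "g \<otimes>\<^bsub>G\<^esub> k \<in> stabilizer G act y"
    using act_mult[OF gG kG assms] G.m_closed[OF gG kG] gy ky by (simp add: stabilizer_def del: carrier_G)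
qed

lemma conjugate_stabilizer:
  assumes k: "k \<in> carrier G" and y: "y \<in> X"
  shows "conjugate_set G k (stabilizer G act y) = stabilizer G act (act k y)"
proof -
  have "conjugate_set G k (stabilizer G act y) = fibre y (act k y) #>\<^bsub>G\<^esub> inv\<^bsub>G\<^esub> k"
    by (simp only: conjugate_set_def stabilizer_eq_fibre translate_fibre[OF k y y])
  also have "\<dots> = stabilizer G act (act k y)"
  proof
    show "fibre y (act k y) #>\<^bsub>G\<^esub> inv\<^bsub>G\<^esub> k \<subseteq> stabilizer G act (act k y)"
    proof
      fix s assume "s \<in> fibre y (act k y) #>\<^bsub>G\<^esub> inv\<^bsub>G\<^esub> k"
      then obtain g where g: "g \<in> carrier G" "act g y = act k y" "s = g \<otimes>\<^bsub>G\<^esub> inv\<^bsub>G\<^esub> k"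
        unfolding r_coset_def by blast
      then show "s \<in> stabilizer G act (act k y)"
        using act_mult[OF g(1) G.inv_closed[OF k] act_closed[OF k y]] k y
          G.m_closed[OF g(1) G.inv_closed[OF k]]
        by (simp add: stabilizer_def del: carrier_G)
    qed
    show "stabilizer G act (act k y) \<subseteq> fibre y (act k y) #>\<^bsub>G\<^esub> inv\<^bsub>G\<^esub> k"
    proof
      fix s assume "s \<in> stabilizer G act (act k y)"
      then have s: "s \<in> carrier G" "act s (act k y) = act k y" by (simp_all add: stabilizer_def)
      have "s \<otimes>\<^bsub>G\<^esub> k \<in> fibre y (act k y)"
        using act_mult[OF s(1) k y] s G.m_closed[OF s(1) k] by (simp del: carrier_G)
      moreover have "s = s \<otimes>\<^bsub>G\<^esub> k \<otimes>\<^bsub>G\<^esub> inv\<^bsub>G\<^esub> k"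
        using G.m_assoc[OF s(1) k G.inv_closed[OF k]] s k by (simp only: G.r_inv G.r_one)
      ultimately show "s \<in> fibre y (act k y) #>\<^bsub>G\<^esub> inv\<^bsub>G\<^esub> k" unfolding r_coset_def by blast
    qed
  qed
  finally show ?thesis .
qed

definition orbit_point :: "'b set \<Rightarrow> 'b" where
  "orbit_point i = (SOME c. c \<in> i)"

text \<open>
  The choice depends on \<open>x\<close> only through its \<open>G\<close>-orbit, so that \<open>rep\<close> is constant on orbits. Different
  \<open>G\<close>-orbits in \<open>X\<close> may lie over the same orbit of labels; this is why a single orbit of labels can need
  several representatives, collected in \<open>reps\<close>.
\<close>

definition rep :: "'x \<Rightarrow> 'x" where
  "rep x = (SOME y. y \<in> orbit G act x \<and> lab y = orbit_point (lab_orbit x))"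

definition orbit_index :: "'b set set" where "orbit_index = lab_orbit ` X"

definition reps :: "'b set \<Rightarrow> 'x set" where "reps i = rep ` {x \<in> X. lab_orbit x = i}"

abbreviation stab :: "'b set \<Rightarrow> 'x \<Rightarrow> ('b \<times> 'b) set" where "stab i j \<equiv> stabilizer G act j"

text \<open>
  The third component is the coset of the stabilizer of \<open>rep x\<close> that corresponds to \<open>x\<close>.
\<close>

definition to_coset :: "'x \<Rightarrow> 'b set \<times> 'x \<times> ('b \<times> 'b) set" where
  "to_coset x = (lab_orbit x, rep x, fibre (rep x) x)"

lemma orbit_point: 
  assumes "i \<in> orbits G (carrier A) Theta" shows "orbit_point i \<in> i"
proof -
  obtain c where c: "c \<in> carrier A" "i = orbit G Theta c" using assms unfolding orbits_def by blast
  then have "Theta \<one>\<^bsub>G\<^esub> c \<in> i" using G.one_closed unfolding orbit_def by blast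
  then show ?thesis unfolding orbit_point_def by (rule someI)
qed

lemma lab_orbit_orbits: "x \<in> X \<Longrightarrow> lab_orbit x \<in> orbits G (carrier A) Theta"
  unfolding orbits_def using lab_closed by blast

lemma rep_act:
  assumes "g \<in> carrier G" "x \<in> X" shows "rep (act g x) = rep x"
proof -
  have "orbit G act (act g x) = orbit G act x" by (rule orbit_act[OF group_G assms act_mult])
  then show ?thesis by (simp only: rep_def lab_orbit_act[OF assms])
qed

text \<open>
  A point with the prescribed label exists in the orbit of \<open>x\<close>: the chosen label is \<open>\<Theta>\<^sub>g(lab x)\<close> for
  some \<open>g\<close>, and this is the label of \<open>act g x\<close>.
\<close>

lemma rep:
  assumes "x \<in> X"
  shows rep_lab: "lab (rep x) = orbit_point (lab_orbit x)"
    and rep_reaches: "\<exists>g\<in>carrier G. act g (rep x) = x"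
    and rep_X: "rep x \<in> X"
    and rep_orbit: "lab_orbit (rep x) = lab_orbit x"
    and rep_rep: "rep (rep x) = rep x"
proof -
  obtain g where g: "g \<in> carrier G" "orbit_point (lab_orbit x) = Theta g (lab x)"
    using orbit_point[OF lab_orbit_orbits[OF assms]] by (auto simp: orbit_def simp del: carrier_G)
  have "act g x \<in> orbit G act x" using g(1) unfolding orbit_def by blast
  moreover have "lab (act g x) = orbit_point (lab_orbit x)" using lab_act[OF g(1) assms] g(2) by simp
  ultimately have "\<exists>y. y \<in> orbit G act x \<and> lab y = orbit_point (lab_orbit x)" by blast
  then have "rep x \<in> orbit G act x \<and> lab (rep x) = orbit_point (lab_orbit x)"
    unfolding rep_def by (rule someI_ex)
  then obtain k where k: "k \<in> carrier G" "rep x = act k x" and l: "lab (rep x) = orbit_point (lab_orbit x)"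
    by (auto simp: orbit_def simp del: carrier_G)
  show "lab (rep x) = orbit_point (lab_orbit x)" by (rule l)
  show "\<exists>g\<in>carrier G. act g (rep x) = x"
    using act_inv_act[OF k(1) assms] G.inv_closed[OF k(1)] k(2) by metis
  show "rep x \<in> X" using act_closed[OF k(1) assms] k(2) by simp
  show o: "lab_orbit (rep x) = lab_orbit x" using lab_orbit_act[OF k(1) assms] k(2) by simp
  show "rep (rep x) = rep x" using rep_act[OF k(1) assms] by (simp only: k(2)[symmetric])
qed

lemma repsE:
  assumes "i \<in> orbit_index" "j \<in> reps i"
  shows "j \<in> X" "lab_orbit j = i" "rep j = j" "lab j = orbit_point i"
proof -
  obtain x where "x \<in> X" "lab_orbit x = i" "j = rep x" using assms(2) by (auto simp: reps_def)
  then show "j \<in> X" "lab_orbit j = i" "rep j = j" "lab j = orbit_point i"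
    using rep[of x] by simp_all
qed

lemma to_coset_act:
  assumes "g \<in> carrier G" "x \<in> X"
  shows "to_coset (act g x) = (lab_orbit x, rep x, g <#\<^bsub>G\<^esub> fibre (rep x) x)"
  using assms by (simp only: to_coset_def lab_orbit_act rep_act translate_fibre rep_X)

lemma to_coset_act_rep:
  assumes "i \<in> orbit_index" "j \<in> reps i" "g \<in> carrier G"
  shows "to_coset (act g j) = (i, j, g <#\<^bsub>G\<^esub> stab i j)"
  using to_coset_act[OF assms(3) repsE(1)[OF assms(1,2)]] repsE[OF assms(1,2)]
  by (simp only: stabilizer_eq_fibre)

lemma bij_to_coset: "bij_betw to_coset X (coset_carrier A M orbit_index reps stab)"
  unfolding bij_betw_def
proof
  show "inj_on to_coset X"
  proof (rule inj_onI)
    fix x y assume x: "x \<in> X" and y: "y \<in> X" and eq: "to_coset x = to_coset y"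
    obtain g where g: "g \<in> carrier G" "act g (rep x) = x" using rep_reaches[OF x] by blast
    then have gx: "g \<in> fibre (rep x) x" by (intro CollectI conjI)
    note e = eq[unfolded to_coset_def prod.inject, THEN conjunct2, THEN conjunct1]
      eq[unfolded to_coset_def prod.inject, THEN conjunct2, THEN conjunct2]
    have "g \<in> fibre (rep y) y" using gx by (rule subst[OF e(2)])
    then have "act g (rep y) = y" by (elim CollectE conjE)
    then show "x = y" using g(2) unfolding e(1) by (rule trans[OF sym, rotated])
  qed
  show "to_coset ` X = coset_carrier A M orbit_index reps stab"
  proof
    show "to_coset ` X \<subseteq> coset_carrier A M orbit_index reps stab"
    proof
      fix t assume "t \<in> to_coset ` X"
      then obtain x where x: "x \<in> X" "t = to_coset x" by blast
      obtain g where g: "g \<in> carrier G" "act g (rep x) = x" using rep_reaches[OF x(1)] by blast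
      have i: "lab_orbit x \<in> orbit_index" using x by (simp add: orbit_index_def)
      have j: "rep x \<in> reps (lab_orbit x)" using x by (simp add: reps_def)
      show "t \<in> coset_carrier A M orbit_index reps stab"
        unfolding x(2) to_coset_act_rep[OF i j g(1), unfolded g(2)] coset_carrier_def LCOSETS_def
        using i j g(1) by blast
    qed
    show "coset_carrier A M orbit_index reps stab \<subseteq> to_coset ` X"
    proof
      fix t assume "t \<in> coset_carrier A M orbit_index reps stab"
      then obtain i j g where t: "t = (i, j, g <#\<^bsub>G\<^esub> stab i j)"
        and ijg: "i \<in> orbit_index" "j \<in> reps i" "g \<in> carrier G"
        unfolding coset_carrier_def LCOSETS_def by blast
      have "act g j \<in> X" by (rule act_closed[OF ijg(3) repsE(1)[OF ijg(1,2)]])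
      then show "t \<in> to_coset ` X" unfolding t to_coset_act_rep[OF ijg, symmetric] by (rule imageI)
    qed
  qed
qed

lemma coset_label_to_coset:
  assumes "x \<in> X" shows "coset_label A M orbit_point (to_coset x) = lab x"
proof -
  obtain g where g: "g \<in> carrier G" "act g (rep x) = x" using rep_reaches[OF assms] by blast
  have "Theta k (orbit_point (lab_orbit x)) = lab x" if "k \<in> fibre (rep x) x" for k
  proof -
    have k: "k \<in> carrier G" "act k (rep x) = x" using that by blast+
    show ?thesis
      using lab_act[OF k(1) rep_X[OF assms]] unfolding k(2) rep_lab[OF assms] by (rule sym)
  qed
  moreover have "g \<in> fibre (rep x) x" using g by blast
  ultimately have "(THE u. \<exists>k\<in>fibre (rep x) x. u = Theta k (orbit_point (lab_orbit x))) = lab x"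
    by (intro the_equality) (blast intro: sym)+
  then show ?thesis by (simp add: coset_label_def to_coset_def)
qed

text \<open>
  Conjugates of the stabilizer of \<open>j\<close> are the stabilizers of the points in the orbit of \<open>j\<close>. Hence the
  two membership conditions are the two fixed point conditions on labels, and the intersection of all
  cores is the kernel of the action on \<open>X\<close>.
\<close>

theorem coset_data_of_action:
  assumes gen: "generate A (lab ` X) = carrier A"
    and faithful: "\<And>b. b \<in> carrier A \<Longrightarrow>
      (\<And>x. x \<in> X \<Longrightarrow> act (\<one>\<^bsub>A\<^esub>, b) x = x \<and> act (b, b) x = x) \<Longrightarrow> b = \<one>\<^bsub>A\<^esub>"
  shows "square_free_brace_coset_data A M orbit_point orbit_index reps stab"
proof (intro square_free_brace_coset_data.intro brace_coset_data.intro
    brace_coset_data_axioms.intro square_free_brace_coset_data_axioms.intro, goal_cases)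
  case 1
  show ?case by (rule skew_left_brace_axioms)
next
  case (2 i)
  then show ?case by (rule orbit_point)
next
  case 3
  show ?case using lab_orbit_orbits by (auto simp: orbit_index_def)
next
  case 4
  show ?case using X_nonempty by (simp add: orbit_index_def)
next
  case 5
  have "lab x \<in> lab_orbit x" if "x \<in> X" for x
    unfolding orbit_def using Theta_one[OF lab_closed[OF that]] G.one_closed
    by (intro CollectI exI[of _ "\<one>\<^bsub>G\<^esub>"]) simp
  then have gens: "lab ` X \<subseteq> \<Union>orbit_index" by (auto simp: orbit_index_def)
  have closed: "\<Union>orbit_index \<subseteq> carrier A"
    unfolding orbit_index_def orbit_def using Theta_closed lab_closed by blast
  show ?case
    using add.mono_generate[OF gens] add.generate_incl[OF closed] unfolding gen
    by (rule subset_antisym[rotated])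
next
  case (6 i)
  then show ?case by (auto simp: orbit_index_def reps_def)
next
  case (7 i j)
  then show ?case by (rule subgroup_stabilizer[OF repsE(1)])
next
  case (8 i j)
  show ?case
  proof
    fix g assume "g \<in> stab i j"
    then have g: "g \<in> carrier G" "act g j = j" by (simp_all add: stabilizer_def)
    then show "g \<in> stabilizer G Theta (orbit_point i)"
      using lab_act[OF g(1) repsE(1)[OF 8]] repsE(4)[OF 8] by (simp add: stabilizer_def)
  qed
next
  case 9
  have core: "normal_core G (stab i j) = (\<Inter>k\<in>carrier G. stabilizer G act (act k j))"
    if "i \<in> orbit_index" "j \<in> reps i" for i j
    unfolding normal_core_def using conjugate_stabilizer repsE(1)[OF that] by simp
  show ?case
  proof (intro equalityI subsetI)
    fix b assume b: "b \<in> {b \<in> carrier A. {(\<one>\<^bsub>A\<^esub>, b), (b, b)}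
        \<subseteq> (\<Inter>i\<in>orbit_index. \<Inter>j\<in>reps i. normal_core G (stab i j))}"
    have "act (\<one>\<^bsub>A\<^esub>, b) x = x \<and> act (b, b) x = x" if x: "x \<in> X" for x
    proof -
      obtain g where g: "g \<in> carrier G" "act g (rep x) = x" using rep_reaches[OF x] by blast
      have i: "lab_orbit x \<in> orbit_index" using x by (simp add: orbit_index_def)
      have j: "rep x \<in> reps (lab_orbit x)" using x by (simp add: reps_def)
      have "{(\<one>\<^bsub>A\<^esub>, b), (b, b)} \<subseteq> normal_core G (stab (lab_orbit x) (rep x))"
        using b i j by (elim CollectE conjE) blast
      then have "{(\<one>\<^bsub>A\<^esub>, b), (b, b)} \<subseteq> stabilizer G act x"
        unfolding core[OF i j] using INT_lower[OF g(1), of "\<lambda>k. stabilizer G act (act k (rep x))"]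
        unfolding g(2) by (rule subset_trans)
      then show ?thesis by (simp add: stabilizer_def)
    qed
    moreover have "b \<in> carrier A" using b by simp
    ultimately have "b = \<one>\<^bsub>A\<^esub>" by (intro faithful[of b])
    then show "b \<in> {\<one>\<^bsub>A\<^esub>}" by simp
  next
    fix b assume "b \<in> {\<one>\<^bsub>A\<^esub>}"
    moreover have "(\<one>\<^bsub>A\<^esub>, \<one>\<^bsub>A\<^esub>) \<in> normal_core G (stab i j)"
      if ij: "i \<in> orbit_index" "j \<in> reps i" for i j
      unfolding core[OF ij]
    proof
      fix k assume "k \<in> carrier G"
      then show "(\<one>\<^bsub>A\<^esub>, \<one>\<^bsub>A\<^esub>) \<in> stabilizer G act (act k j)"
        using act_one[OF act_closed[OF _ repsE(1)[OF ij]], of k] by (simp add: stabilizer_def)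
    qed
    ultimately show "b \<in> {b \<in> carrier A. {(\<one>\<^bsub>A\<^esub>, b), (b, b)}
        \<subseteq> (\<Inter>i\<in>orbit_index. \<Inter>j\<in>reps i. normal_core G (stab i j))}"
      by simp
  qed
next
  case (10 b c i j)
  have bc: "(b, c) \<in> carrier G" using 10 by simp
  have j: "j \<in> X" "lab j = orbit_point i" using repsE[OF 10(3,4)] by simp_all
  have l: "Theta (b, c) (orbit_point i) = lab (act (b, c) j)" using lab_act[OF bc j(1)] j(2) by simp
  show ?case
    unfolding conjugate_stabilizer[OF bc j(1)] l
    using lab_fixes[OF act_closed[OF bc j(1)]] lab_closed[OF act_closed[OF bc j(1)]]
    by (simp add: stabilizer_def)
next
  case (11 b c i j)
  have bc: "(b, c) \<in> carrier G" using 11 by simp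
  have j: "j \<in> X" "lab j = orbit_point i" using repsE[OF 11(3,4)] by simp_all
  have l: "Theta (b, c) (orbit_point i) = lab (act (b, c) j)" using lab_act[OF bc j(1)] j(2) by simp
  show ?case
    unfolding conjugate_stabilizer[OF bc j(1)] l
    using diag_lab_fixes[OF act_closed[OF bc j(1)]] lab_closed[OF act_closed[OF bc j(1)]]
    by (simp add: stabilizer_def)
qed

theorem isomorphic_coset_solution:
  assumes r: "\<And>x y. x \<in> X \<Longrightarrow> y \<in> X \<Longrightarrow>
    r (x, y) = (act (\<one>\<^bsub>A\<^esub>, lab x) y,
                act (inv\<^bsub>G\<^esub> (lab (act (\<one>\<^bsub>A\<^esub>, lab x) y), lab (act (\<one>\<^bsub>A\<^esub>, lab x) y))) x)"
  shows "isomorphic_solutions X r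
    (coset_carrier A M orbit_index reps stab) (coset_map A M orbit_point)"
  unfolding isomorphic_solutions_def
proof (intro exI[of _ to_coset] conjI ballI)
  show "bij_betw to_coset X (coset_carrier A M orbit_index reps stab)" by (rule bij_to_coset)
  fix x y assume x: "x \<in> X" and y: "y \<in> X"
  have u: "(\<one>\<^bsub>A\<^esub>, lab x) \<in> carrier G" using lab_closed[OF x] by simp
  define w where "w = lab (act (\<one>\<^bsub>A\<^esub>, lab x) y)"
  have w: "inv\<^bsub>G\<^esub> (w, w) \<in> carrier G"
    using lab_closed[OF act_closed[OF u y]] by (intro G.inv_closed) (simp add: w_def)
  have "coset_map A M orbit_point (to_coset x, to_coset y)
      = (to_coset (act (\<one>\<^bsub>A\<^esub>, lab x) y), to_coset (act (inv\<^bsub>G\<^esub> (w, w)) x))"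
    unfolding to_coset_act[OF u y] to_coset_act[OF w x] coset_map_def prod.case Let_def
      coset_label_to_coset[OF x] coset_label_to_coset[OF y] lab_act[OF u y, folded w_def, symmetric]
    by (simp only: to_coset_def prod.case)
  also have "\<dots> = map_prod to_coset to_coset (r (x, y))"
    by (simp only: r[OF x y] w_def map_prod_simp)
  finally show "coset_map A M orbit_point (to_coset x, to_coset y)
      = map_prod to_coset to_coset (r (x, y))" .
qed

end

section \<open>Groups from commuting families of permutations\<close>

text \<open>
  A set acted on by two commuting families of permutations, each of which generates a transitive group,
  is a torsor for both groups. Fixing a base point \<open>e\<close> turns the set into a group in which the
  \<open>R i\<close> are right translations and the \<open>L i\<close> left translations, by the same elements because of \<open>L_e\<close>.
  The condition \<open>R_minimal\<close> is transitivity of the group generated by the \<open>R i\<close>, in the form of an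
  induction principle.
\<close>

locale commuting_translations =
  fixes S :: "'s set" and e :: 's and R L :: "'i \<Rightarrow> 's \<Rightarrow> 's"
  assumes e_in: "e \<in> S"
    and R_bij: "bij_betw (R i) S S"
    and L_bij: "bij_betw (L i) S S"
    and L_R: "s \<in> S \<Longrightarrow> L i (R j s) = R j (L i s)"
    and L_e: "L i e = R i e"
    and R_minimal: "\<lbrakk>T \<subseteq> S; e \<in> T; \<And>i s. s \<in> T \<Longrightarrow> R i s \<in> T;
        \<And>i s. s \<in> S \<Longrightarrow> R i s \<in> T \<Longrightarrow> s \<in> T\<rbrakk> \<Longrightarrow> T = S"
begin

lemma R_closed: "s \<in> S \<Longrightarrow> R i s \<in> S" and L_closed: "s \<in> S \<Longrightarrow> L i s \<in> S"
  using R_bij L_bij bij_betwE by blast+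

lemma R_inj: "s \<in> S \<Longrightarrow> t \<in> S \<Longrightarrow> R i s = R i t \<Longrightarrow> s = t"
  and L_inj: "s \<in> S \<Longrightarrow> t \<in> S \<Longrightarrow> L i s = L i t \<Longrightarrow> s = t"
  using R_bij L_bij by (meson bij_betw_def inj_on_def)+

text \<open>
  The orbit of the base point under the group generated by the \<open>L i\<close>; the third rule stands for the
  inverses.
\<close>

inductive_set L_orbit :: "'s set" where
  base: "e \<in> L_orbit"
| step: "s \<in> L_orbit \<Longrightarrow> L i s \<in> L_orbit"
| unstep: "s \<in> S \<Longrightarrow> L i s \<in> L_orbit \<Longrightarrow> s \<in> L_orbit"

lemma L_orbit_subset: "s \<in> L_orbit \<Longrightarrow> s \<in> S"
  by (induction rule: L_orbit.induct) (auto simp: e_in L_closed)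

text \<open>
  The orbit of \<open>e\<close> under the \<open>L i\<close> is also stable under the \<open>R i\<close> and their inverses: these commute with the \<open>L j\<close>, so they can be moved down to \<open>e\<close>, where \<open>R i\<close>
  and \<open>L i\<close> agree.
\<close>

lemma L_orbit_eq: "L_orbit = S"
proof (rule R_minimal)
  show "L_orbit \<subseteq> S" using L_orbit_subset by blast
  show "e \<in> L_orbit" by (rule L_orbit.base)
  show "R i s \<in> L_orbit" if "s \<in> L_orbit" for i s
    using that
  proof (induction rule: L_orbit.induct)
    case base
    show ?case using L_orbit.step[OF L_orbit.base, of i] by (simp add: L_e)
  next
    case (step s j)
    then show ?case by (metis L_R L_orbit.step L_orbit_subset)
  next
    case (unstep s j)
    then show ?case by (metis L_R L_orbit.unstep R_closed)
  qed
  have "\<forall>s\<in>S. R i s = t \<longrightarrow> s \<in> L_orbit" if "t \<in> L_orbit" for i t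
    using that
  proof (induction rule: L_orbit.induct)
    case base
    show ?case
    proof (intro ballI impI)
      fix s assume s: "s \<in> S" "R i s = e"
      then have "R i (L i s) = R i e" by (metis L_R L_e)
      then have "L i s = e" using R_inj s e_in L_closed by blast
      then show "s \<in> L_orbit" using L_orbit.unstep L_orbit.base s by metis
    qed
  next
    case (step t j)
    show ?case
    proof (intro ballI impI)
      fix s assume s: "s \<in> S" "R i s = L j t"
      then obtain s' where s': "s' \<in> S" "s = L j s'"
        using L_bij[of j] by (metis bij_betw_def imageE)
      then have "R i s' = t"
        using s step L_R L_inj R_closed L_orbit_subset by metis
      then show "s \<in> L_orbit" using step s' L_orbit.step by blast
    qed
  next
    case (unstep t j)
    then show ?case by (metis L_R L_closed L_orbit.unstep)
  qed
  then show "s \<in> L_orbit" if "s \<in> S" "R i s \<in> L_orbit" for i s using that by blast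
qed

definition right_translation :: "('s \<Rightarrow> 's) \<Rightarrow> bool" where
  "right_translation \<rho> \<longleftrightarrow> bij_betw \<rho> S S \<and> (\<forall>i. \<forall>s\<in>S. \<rho> (L i s) = L i (\<rho> s))"

lemma right_translation_closed: "right_translation \<rho> \<Longrightarrow> s \<in> S \<Longrightarrow> \<rho> s \<in> S"
  unfolding right_translation_def using bij_betwE by blast

text \<open>
  Where two maps that commute with the \<open>L i\<close> agree is a set stable under the \<open>L i\<close> and their inverses.
\<close>

lemma right_translation_eqI:
  assumes "right_translation \<rho>" "right_translation \<rho>'" "\<rho> e = \<rho>' e" "s \<in> S"
  shows "\<rho> s = \<rho>' s"
proof -
  have "s \<in> L_orbit" using assms L_orbit_eq by simp
  then show ?thesis
  proof (induction rule: L_orbit.induct)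
    case (step s i)
    then show ?case using assms L_orbit_eq by (metis right_translation_def)
  next
    case (unstep s i)
    then show ?case using assms L_inj right_translation_closed by (metis right_translation_def)
  qed (rule assms)
qed

lemma right_translation_comp:
  "right_translation \<rho> \<Longrightarrow> right_translation \<rho>' \<Longrightarrow> right_translation (\<lambda>s. \<rho>' (\<rho> s))"
  using bij_betw_trans[of \<rho> S S \<rho>' S] bij_betwE[of \<rho> S S]
  by (simp add: right_translation_def comp_def)

lemma right_translation_R: "right_translation (R i)"
  by (simp add: right_translation_def R_bij L_R)

lemma right_translation_inv:
  assumes "right_translation \<rho>" shows "right_translation (inv_into S \<rho>)"
  unfolding right_translation_def
proof (intro conjI allI ballI)
  have b: "bij_betw \<rho> S S" using assms by (simp add: right_translation_def)
  show "bij_betw (inv_into S \<rho>) S S" by (rule bij_betw_inv_into[OF b])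
  fix i s assume s: "s \<in> S"
  let ?t = "inv_into S \<rho> s"
  have t: "?t \<in> S" "\<rho> ?t = s" using b s
    by (auto simp: bij_betw_def inv_into_into f_inv_into_f)
  then have "\<rho> (L i ?t) = L i s" using assms by (simp add: right_translation_def)
  then show "inv_into S \<rho> (L i s) = L i ?t"
    using b t L_closed by (metis bij_betw_inv_into_left)
qed

lemma right_translation_exists:
  assumes "c \<in> S" shows "\<exists>\<rho>. right_translation \<rho> \<and> \<rho> e = c"
proof -
  define Q where "Q c \<longleftrightarrow> (\<exists>\<rho>. right_translation \<rho> \<and> \<rho> e = c)" for c
  have Q: "Q (\<rho> e)" if "right_translation \<rho>" for \<rho>
    unfolding Q_def by (rule exI[of _ \<rho>]) (simp add: that)
  have "{c \<in> S. Q c} = S"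
  proof (rule R_minimal)
    show "{c \<in> S. Q c} \<subseteq> S" by simp
    show "e \<in> {c \<in> S. Q c}"
      using Q[of "\<lambda>s. s"] e_in by (simp add: right_translation_def bij_betw_def)
    show "R i s \<in> {c \<in> S. Q c}" if "s \<in> {c \<in> S. Q c}" for i s
    proof -
      have s: "s \<in> S" "Q s" using that by simp_all
      from s(2) obtain \<rho> where \<rho>: "right_translation \<rho>" "\<rho> e = s"
        unfolding Q_def by (elim exE conjE)
      show ?thesis
        using Q[OF right_translation_comp[OF \<rho>(1) right_translation_R[of i]]] \<rho>(2) R_closed[OF s(1)]
        by simp
    qed
    show "s \<in> {c \<in> S. Q c}" if s: "s \<in> S" and Rs: "R i s \<in> {c \<in> S. Q c}" for i s
    proof -
      have "Q (R i s)" using Rs by simp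
      then obtain \<rho> where \<rho>: "right_translation \<rho>" "\<rho> e = R i s"
        unfolding Q_def by (elim exE conjE)
      have "inv_into S (R i) (\<rho> e) = s"
        using \<rho>(2) bij_betw_inv_into_left[OF R_bij s] by simp
      then show ?thesis
        using Q[OF right_translation_comp[OF \<rho>(1) right_translation_inv[OF right_translation_R[of i]]]] s
        by simp
    qed
  qed
  then have "Q c" using assms by blast
  then show ?thesis by (simp only: Q_def)
qed

definition translation :: "'s \<Rightarrow> 's \<Rightarrow> 's" where
  "translation c = (SOME \<rho>. right_translation \<rho> \<and> \<rho> e = c)"

lemma translation_spec:
  assumes "c \<in> S" shows "right_translation (translation c) \<and> translation c e = c"
  unfolding translation_def by (rule someI_ex[OF right_translation_exists[OF assms]])

lemmas translation = translation_spec[THEN conjunct1]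
  and translation_e = translation_spec[THEN conjunct2]

lemma right_translation_eq:
  assumes "right_translation \<rho>" "s \<in> S"
  shows "\<rho> s = translation (\<rho> e) s"
proof -
  have "\<rho> e \<in> S" by (rule right_translation_closed[OF assms(1) e_in])
  then show ?thesis
    by (intro right_translation_eqI[OF assms(1) translation _ assms(2)]) (simp_all add: translation_e)
qed

definition translation_group :: "'s monoid" where
  "translation_group = \<lparr>carrier = S, mult = (\<lambda>b c. translation c b), one = e\<rparr>"

lemma carrier_translation_group [simp]: "carrier translation_group = S"
  and mult_translation_group: "b \<otimes>\<^bsub>translation_group\<^esub> c = translation c b"
  and one_translation_group [simp]: "\<one>\<^bsub>translation_group\<^esub> = e"
  by (simp_all add: translation_group_def)

lemma group_translation_group: "group translation_group"
proof (rule groupI)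
  fix x y z
  assume "x \<in> carrier translation_group" "y \<in> carrier translation_group" "z \<in> carrier translation_group"
  then show "x \<otimes>\<^bsub>translation_group\<^esub> y \<otimes>\<^bsub>translation_group\<^esub> z
      = x \<otimes>\<^bsub>translation_group\<^esub> (y \<otimes>\<^bsub>translation_group\<^esub> z)"
    using right_translation_eq[OF right_translation_comp[OF translation translation], of y z x]
    by (simp add: mult_translation_group translation_e)
next
  fix x assume "x \<in> carrier translation_group"
  then have x: "x \<in> S" by simp
  then obtain y where "y \<in> S" "translation x y = e"
    using translation[OF x] e_in unfolding right_translation_def by (metis bij_betw_def imageE)
  then show "\<exists>y\<in>carrier translation_group. y \<otimes>\<^bsub>translation_group\<^esub> x = \<one>\<^bsub>translation_group\<^esub>"
    by (auto simp: mult_translation_group)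
qed (auto simp: e_in mult_translation_group translation_e
      intro: right_translation_closed[OF translation])

lemma translation_id: "b \<in> S \<Longrightarrow> translation e b = b"
  using right_translation_eq[of "\<lambda>s. s" b] by (simp add: right_translation_def bij_betw_def)

lemma mult_R:
  assumes "b \<in> S" "c \<in> S"
  shows "b \<otimes>\<^bsub>translation_group\<^esub> R i c = R i (b \<otimes>\<^bsub>translation_group\<^esub> c)"
  using right_translation_eq[OF right_translation_comp[OF translation right_translation_R], of c b i] assms
  by (simp add: mult_translation_group translation_e)

lemma L_mult:
  assumes "b \<in> S" "c \<in> S"
  shows "L i b \<otimes>\<^bsub>translation_group\<^esub> c = L i (b \<otimes>\<^bsub>translation_group\<^esub> c)"
  using translation[OF assms(2)] assms by (simp add: mult_translation_group right_translation_def)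

lemma R_eq_mult: "b \<in> S \<Longrightarrow> R i b = b \<otimes>\<^bsub>translation_group\<^esub> R i e"
  using mult_R[of b e i] e_in by (simp add: mult_translation_group translation_id)

lemma L_eq_mult: "c \<in> S \<Longrightarrow> L i c = R i e \<otimes>\<^bsub>translation_group\<^esub> c"
  using L_mult[of e c i] e_in by (simp add: mult_translation_group translation_e L_e)

text \<open>
  Conjugation by \<open>m\<close> permutes the left translations, hence preserves the set of maps that commute with
  all of them, that is, the set of right translations. So \<open>m\<close> turns the right translation by \<open>c\<close> into the right translation
  by some \<open>d\<close>, which is determined by its effect on \<open>m e\<close>. For \<open>m\<close> a left multiplication in a second
  group on the same set, the conclusion is the compatibility axiom of a skew left brace.
\<close>

lemma semilinear_map:
  assumes m: "bij_betw m S S" and \<pi>: "surj \<pi>"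
    and mL: "\<And>i s. s \<in> S \<Longrightarrow> m (L i s) = L (\<pi> i) (m s)"
    and b: "b \<in> S" and c: "c \<in> S"
  shows "\<exists>d\<in>S. m c = m e \<otimes>\<^bsub>translation_group\<^esub> d \<and>
    m (b \<otimes>\<^bsub>translation_group\<^esub> c) = m b \<otimes>\<^bsub>translation_group\<^esub> d"
proof -
  let ?n = "inv_into S m"
  define \<rho> where "\<rho> = (\<lambda>s. m (translation c (?n s)))"
  have tr: "right_translation (translation c)" using translation c by blast
  have n: "bij_betw ?n S S" by (rule bij_betw_inv_into[OF m])
  have nm: "?n (m s) = s" if "s \<in> S" for s using m that by (simp add: bij_betw_inv_into_left)
  have "right_translation \<rho>"
    unfolding right_translation_def
  proof (intro conjI allI ballI)
    have "bij_betw (translation c) S S" using tr by (simp add: right_translation_def)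
    from bij_betw_trans[OF bij_betw_trans[OF n this] m]
    show "bij_betw \<rho> S S" by (simp add: \<rho>_def comp_def)
    fix j s assume s: "s \<in> S"
    obtain i where i: "j = \<pi> i" using \<pi> by (metis surjD)
    obtain t where t: "t \<in> S" "s = m t" using s m by (metis bij_betw_def imageE)
    have "\<rho> (L j s) = m (translation c (L i t))"
      using t nm by (simp add: \<rho>_def i mL[symmetric] L_closed)
    also have "\<dots> = m (L i (translation c t))" using tr t by (simp add: right_translation_def)
    also have "\<dots> = L j (\<rho> s)"
      using t nm right_translation_closed[OF tr] by (simp add: \<rho>_def i mL)
    finally show "\<rho> (L j s) = L j (\<rho> s)" .
  qed
  then have e\<rho>: "\<rho> e \<in> S" and \<rho>: "\<rho> (m s) = m s \<otimes>\<^bsub>translation_group\<^esub> \<rho> e" if "s \<in> S" for s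
    using that bij_betw_apply[OF m] right_translation_eq[of \<rho> "m s"]
      right_translation_closed[of \<rho> e] e_in
    by (simp_all add: mult_translation_group)
  moreover have "\<rho> (m s) = m (s \<otimes>\<^bsub>translation_group\<^esub> c)" if "s \<in> S" for s
    using that nm by (simp add: \<rho>_def mult_translation_group)
  moreover have "e \<otimes>\<^bsub>translation_group\<^esub> c = c"
    using translation_e[OF c] by (simp add: mult_translation_group)
  ultimately show ?thesis using b e_in by metis
qed

end

section \<open>The skew left brace generated by a square-free solution\<close>

text \<open>
  A name for the inverse of a permutation, as the notation \<open>inv\<close> refers to inverses in a group.
\<close>

abbreviation pinv :: "('x \<Rightarrow> 'x) \<Rightarrow> 'x \<Rightarrow> 'x" where "pinv \<equiv> inv_into UNIV"

definition perm_pairs :: "(('x \<Rightarrow> 'x) \<times> ('x \<Rightarrow> 'x)) monoid" where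
  "perm_pairs = \<lparr>carrier = {p. bij (fst p) \<and> bij (snd p)},
     mult = (\<lambda>p q. (fst p \<circ> fst q, snd p \<circ> snd q)), one = (id, id)\<rparr>"

lemma perm_pairs_simps [simp]:
  "p \<in> carrier perm_pairs \<longleftrightarrow> bij (fst p) \<and> bij (snd p)"
  "fst (p \<otimes>\<^bsub>perm_pairs\<^esub> q) = fst p \<circ> fst q"
  "snd (p \<otimes>\<^bsub>perm_pairs\<^esub> q) = snd p \<circ> snd q"
  "\<one>\<^bsub>perm_pairs\<^esub> = (id, id)"
  by (simp_all add: perm_pairs_def)

lemma group_perm_pairs: "group perm_pairs"
proof (rule groupI)
  fix p :: "('x \<Rightarrow> 'x) \<times> ('x \<Rightarrow> 'x)" assume "p \<in> carrier perm_pairs"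
  then show "\<exists>q\<in>carrier perm_pairs. q \<otimes>\<^bsub>perm_pairs\<^esub> p = \<one>\<^bsub>perm_pairs\<^esub>"
    by (intro bexI[of _ "(pinv (fst p), pinv (snd p))"])
       (auto simp: prod_eq_iff bij_imp_bij_inv bij_is_inj)
qed (auto simp: prod_eq_iff o_assoc bij_comp)

interpretation PP: group "perm_pairs :: (('x \<Rightarrow> 'x) \<times> ('x \<Rightarrow> 'x)) monoid"
  by (rule group_perm_pairs)

lemma perm_pairs_inv:
  assumes "bij (fst p)" "bij (snd p)"
  shows "inv\<^bsub>perm_pairs\<^esub> p = (pinv (fst p), pinv (snd p))"
  using assms
  by (intro PP.inv_equality) (auto simp: prod_eq_iff bij_imp_bij_inv bij_is_inj)

text \<open>
  The maps \<open>f x\<close> are the left components of a square-free solution, and \<open>h y\<close> is the inverse of its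
  right component \<open>g y\<close>. The point \<open>pinv (h (f x y)) x\<close> is then \<open>g y x\<close>, as \<open>g (f x y)\<close> and
  \<open>g y\<close> agree at \<open>x\<close> for square-free solutions, so that \<open>f_f\<close> and \<open>h_h\<close> are the
  two outer components of the braid equation. The last assumption says that \<open>f x\<close> is an automorphism of
  the rack given by the permutations \<open>h y \<circ> pinv (f y)\<close>.
\<close>

locale square_free_permutations =
  fixes f h :: "'x \<Rightarrow> 'x \<Rightarrow> 'x"
  assumes bij_f: "bij (f x)" and bij_h: "bij (h x)"
    and f_self: "f x x = x" and h_self: "h x x = x"
    and f_f: "f x \<circ> f y = f (f x y) \<circ> f (pinv (h (f x y)) x)"
    and h_h: "h x \<circ> h y = h (f x y) \<circ> h (pinv (h (f x y)) x)"
    and f_rack: "f x (h y (pinv (f y) z)) = h (f x y) (pinv (f (f x y)) (f x z))"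
begin

abbreviation P :: "(('x \<Rightarrow> 'x) \<times> ('x \<Rightarrow> 'x)) monoid" where "P \<equiv> perm_pairs"

definition gen :: "'x \<Rightarrow> ('x \<Rightarrow> 'x) \<times> ('x \<Rightarrow> 'x)" where "gen x = (f x, h x)"

definition B :: "(('x \<Rightarrow> 'x) \<times> ('x \<Rightarrow> 'x)) set" where "B = generate P (range gen)"

text \<open>
  If \<open>b\<close> is the pair of permutations by which \<open>(1, b)\<close> and \<open>(b, b)\<close> are to act, then \<open>sg b\<close> is the action of
  \<open>(b, 1) = (b, b)(1, b)\<inverse>\<close>.
\<close>

definition sg :: "('x \<Rightarrow> 'x) \<times> ('x \<Rightarrow> 'x) \<Rightarrow> 'x \<Rightarrow> 'x" where "sg b = snd b \<circ> pinv (fst b)"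

text \<open>
  \<open>R x b\<close> is to become \<open>b \<star> gen x\<close>, in view of \<open>b \<star> c = b \<cdot> \<lambda>\<^sub>b\<inverse>(c)\<close> and \<open>\<lambda>\<^sub>b(gen y) = gen (fst b y)\<close>; and \<open>L x b\<close> is
  to become \<open>gen x \<star> b\<close>, in view of \<open>b \<star> gen y \<star> b\<^sup>\<star> = gen (sg b y)\<close>. The inverse of \<open>R x\<close> will be
  \<open>R_back x\<close>.
\<close>

definition R :: "'x \<Rightarrow> ('x \<Rightarrow> 'x) \<times> ('x \<Rightarrow> 'x) \<Rightarrow> ('x \<Rightarrow> 'x) \<times> ('x \<Rightarrow> 'x)" where
  "R x b = b \<otimes>\<^bsub>P\<^esub> gen (pinv (fst b) x)"

definition R_back :: "'x \<Rightarrow> ('x \<Rightarrow> 'x) \<times> ('x \<Rightarrow> 'x) \<Rightarrow> ('x \<Rightarrow> 'x) \<times> ('x \<Rightarrow> 'x)" where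
  "R_back x b = b \<otimes>\<^bsub>P\<^esub> inv\<^bsub>P\<^esub> gen (pinv (fst b) x)"

definition L :: "'x \<Rightarrow> ('x \<Rightarrow> 'x) \<times> ('x \<Rightarrow> 'x) \<Rightarrow> ('x \<Rightarrow> 'x) \<times> ('x \<Rightarrow> 'x)" where
  "L x b = R (pinv (sg b) x) b"

lemma gen_simps [simp]: "fst (gen x) = f x" "snd (gen x) = h x"
  by (simp_all add: gen_def)

lemma gen_closed: "gen x \<in> carrier P" by (simp add: bij_f bij_h)

lemma subgroup_B: "subgroup B P"
  unfolding B_def by (rule PP.generate_is_subgroup) (auto simp: bij_f bij_h)

lemma B_perm: "b \<in> B \<Longrightarrow> b \<in> carrier P"
  by (rule subgroup.mem_carrier[OF subgroup_B])

lemma B_bij [simp]: "b \<in> B \<Longrightarrow> bij (fst b)" "b \<in> B \<Longrightarrow> bij (snd b)"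
  using B_perm by auto

lemma one_B: "(id, id) \<in> B" using subgroup.one_closed[OF subgroup_B] by simp

lemma mult_B: "a \<in> B \<Longrightarrow> b \<in> B \<Longrightarrow> a \<otimes>\<^bsub>P\<^esub> b \<in> B"
  using subgroup.m_closed[OF subgroup_B] .

lemma inv_B: "a \<in> B \<Longrightarrow> inv\<^bsub>P\<^esub> a \<in> B"
  using subgroup.m_inv_closed[OF subgroup_B] .

lemma gen_B: "gen x \<in> B" by (simp add: B_def generate.incl)

lemma R_B: "b \<in> B \<Longrightarrow> R x b \<in> B" and R_back_B: "b \<in> B \<Longrightarrow> R_back x b \<in> B"
  by (simp_all add: R_def R_back_def mult_B gen_B inv_B)

lemma L_B: "b \<in> B \<Longrightarrow> L x b \<in> B" by (simp add: L_def R_B)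

lemma inv_fst [simp]: "b \<in> B \<Longrightarrow> pinv (fst b) (fst b x) = x"
   "b \<in> B \<Longrightarrow> fst b (pinv (fst b) x) = x"
   "b \<in> B \<Longrightarrow> pinv (snd b) (snd b x) = x"
   "b \<in> B \<Longrightarrow> snd b (pinv (snd b) x) = x"
  by (simp_all only: inv_f_f[OF bij_is_inj] surj_f_inv_f[OF bij_is_surj] B_bij)

lemma inv_fh [simp]: "pinv (f y) (f y x) = x" "f y (pinv (f y) x) = x"
   "pinv (h y) (h y x) = x" "h y (pinv (h y) x) = x"
  by (simp_all only: inv_f_f[OF bij_is_inj] surj_f_inv_f[OF bij_is_surj] bij_f bij_h)

lemma sg_bij [simp]: "b \<in> B \<Longrightarrow> bij (sg b)"
  unfolding sg_def by (intro bij_comp bij_imp_bij_inv) auto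

lemma inv_sg: "b \<in> B \<Longrightarrow> pinv (sg b) x = fst b (pinv (snd b) x)"
  by (rule inv_f_eq) (auto simp: bij_is_inj, simp add: sg_def)

lemma sg_gen: "sg (gen x) = h x \<circ> pinv (f x)" by (simp add: sg_def)

lemma sg_one [simp]: "sg (id, id) = id" by (simp add: sg_def)

lemma B_rack:
  assumes "b \<in> B" shows "fst b (sg (gen y) t) = sg (gen (fst b y)) (fst b t)"
proof -
  have "\<forall>y t. fst b (sg (gen y) t) = sg (gen (fst b y)) (fst b t)"
    using assms unfolding B_def
  proof (induction rule: generate.induct)
    case (incl b)
    then show ?case by (auto simp: sg_gen f_rack)
  next
    case (inv b)
    then obtain x where b: "b = gen x" by auto
    have "pinv (f x) (sg (gen y) t) = sg (gen (pinv (f x) y)) (pinv (f x) t)" for y t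
    proof -
      have "f x (sg (gen (pinv (f x) y)) (pinv (f x) t)) = sg (gen y) t"
        by (simp add: sg_gen f_rack)
      then show ?thesis by (metis inv_fh(1))
    qed
    then show ?case using b by (simp add: perm_pairs_inv bij_f bij_h)
  qed simp_all
  then show ?thesis by blast
qed

lemma sg_R: "b \<in> B \<Longrightarrow> sg (R x b) = sg b \<circ> sg (gen x)"
proof
  fix t assume b: "b \<in> B"
  define y where "y = pinv (fst b) x"
  have "pinv (fst b \<circ> f y) = pinv (f y) \<circ> pinv (fst b)"
    using b by (simp add: o_inv_distrib bij_f)
  moreover have "R x b = b \<otimes>\<^bsub>P\<^esub> gen y" by (simp only: R_def y_def)
  ultimately have 1: "sg (R x b) t = snd b (sg (gen y) (pinv (fst b) t))"
    by (simp only: sg_def perm_pairs_simps(2,3) gen_simps o_apply)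
  have "fst b (sg (gen y) (pinv (fst b) t)) = sg (gen x) t"
    using B_rack[OF b, of y "pinv (fst b) t"] by (simp only: y_def inv_fst(2)[OF b])
  then have "sg (gen y) (pinv (fst b) t) = pinv (fst b) (sg (gen x) t)"
    using inv_fst(1)[OF b] by metis
  with 1 show "sg (R x b) t = (sg b \<circ> sg (gen x)) t" by (simp only: sg_def[of b] o_apply)
qed

lemma gen_gen: "gen x \<otimes>\<^bsub>P\<^esub> gen y = gen (f x y) \<otimes>\<^bsub>P\<^esub> gen (pinv (h (f x y)) x)"
  by (rule prod_eqI; simp only: perm_pairs_simps(2,3) gen_simps; (rule f_f | rule h_h))

text \<open>
  The right translations satisfy the relations \<open>x \<star> y = y \<star> \<sigma>\<^sub>y\<inverse>(x)\<close> of the rack. After \<open>b\<close> is moved to the left,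
  this is the relation \<open>gen_gen\<close> between the generators.
\<close>

lemma R_R:
  assumes "b \<in> B"
  shows "R y (R x b) = R (pinv (sg (gen y)) x) (R y b)"
proof -
  let ?x = "pinv (fst b) x" and ?y = "pinv (fst b) y"
  have b: "b \<in> carrier P" using B_perm assms .
  have i: "pinv (fst b \<circ> f u) = pinv (f u) \<circ> pinv (fst b)" for u
    using assms by (simp add: o_inv_distrib bij_f)
  have "pinv (fst b) (pinv (sg (gen y)) x) = pinv (sg (gen ?y)) ?x"
  proof -
    have "fst b (sg (gen ?y) (pinv (sg (gen ?y)) ?x)) = x"
      using assms gen_B by (simp add: surj_f_inv_f bij_is_surj)
    then have "sg (gen y) (fst b (pinv (sg (gen ?y)) ?x)) = x"
      using assms by (simp add: B_rack)
    then have "pinv (sg (gen y)) x = fst b (pinv (sg (gen ?y)) ?x)"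
      using gen_B by (metis bij_inv_eq_iff sg_bij)
    then show ?thesis using assms by simp
  qed
  then have *: "pinv (f ?y) (pinv (fst b) (pinv (sg (gen y)) x)) = pinv (h ?y) ?x"
    by (simp add: inv_sg gen_B)
  have "R y (R x b) = b \<otimes>\<^bsub>P\<^esub> (gen ?x \<otimes>\<^bsub>P\<^esub> gen (pinv (f ?x) ?y))"
    using b by (simp add: R_def i PP.m_assoc gen_closed del: perm_pairs_simps(1,4))
  also have "\<dots> = b \<otimes>\<^bsub>P\<^esub> (gen ?y \<otimes>\<^bsub>P\<^esub> gen (pinv (h ?y) ?x))"
    by (simp add: gen_gen[of ?x])
  also have "\<dots> = R (pinv (sg (gen y)) x) (R y b)"
    using b * by (simp add: R_def i PP.m_assoc gen_closed del: perm_pairs_simps(1,4))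
  finally show ?thesis .
qed

text \<open>
  With \<open>z = f\<^sub>b\<inverse>(x)\<close>, both maps multiply \<open>b\<close> by \<open>gen z\<close> or its inverse. The point at which the second map is to
  be evaluated is again \<open>z\<close>, because \<open>f z z = z\<close>.
\<close>

lemma R_R_back: "b \<in> B \<Longrightarrow> R x (R_back x b) = b"
  and R_back_R: "b \<in> B \<Longrightarrow> R_back x (R x b) = b"
proof -
  assume b: "b \<in> B"
  let ?x = "pinv (fst b) x"
  have P: "b \<in> carrier P" "inv\<^bsub>P\<^esub> gen ?x \<in> carrier P" using B_perm b gen_closed by blast+
  have i: "pinv (pinv (f ?x)) = f ?x" by (simp add: inv_inv_eq bij_f)
  have "pinv (fst (R_back x b)) = f ?x \<circ> pinv (fst b)"
    using b by (simp add: R_back_def perm_pairs_inv bij_f bij_h o_inv_distrib bij_imp_bij_inv i)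
  then have "pinv (fst (R_back x b)) x = ?x" by (simp add: f_self)
  then have "R x (R_back x b) = R_back x b \<otimes>\<^bsub>P\<^esub> gen ?x" by (simp only: R_def)
  also have "\<dots> = b"
    using P gen_closed[of ?x] by (simp add: R_back_def PP.m_assoc del: perm_pairs_simps)
  finally show "R x (R_back x b) = b" .
  have "pinv (fst (R x b)) = pinv (f ?x) \<circ> pinv (fst b)"
    using b by (simp add: R_def o_inv_distrib bij_f)
  then have "pinv (fst (R x b)) x = ?x" by (simp, metis f_self inv_fh(1))
  then have "R_back x (R x b) = R x b \<otimes>\<^bsub>P\<^esub> inv\<^bsub>P\<^esub> gen ?x" by (simp only: R_back_def)
  also have "\<dots> = b"
    using P gen_closed[of ?x] by (simp add: R_def PP.m_assoc del: perm_pairs_simps)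
  finally show "R_back x (R x b) = b" .
qed

lemma R_bij: "bij_betw (R x) B B"
  by (rule bij_betw_byWitness[where f' = "R_back x"]) (auto simp: R_R_back R_back_R R_B R_back_B)

lemma sg_gen_self: "sg (gen x) x = x"
  by (simp add: sg_gen) (metis f_self h_self inv_fh(1))

text \<open>
  \<open>L x\<close> applies \<open>R z\<close> to \<open>b\<close> for the point \<open>z\<close> with \<open>sg b z = x\<close>. The image of \<open>b\<close> determines the same
  point \<open>z\<close>, because \<open>sg (gen z)\<close> fixes \<open>z\<close>; so \<open>R_back z\<close> undoes the step.
\<close>

lemma L_bij: "bij_betw (L x) B B"
proof (rule bij_betw_byWitness[where f' = "\<lambda>b. R_back (pinv (sg b) x) b"]; (intro ballI image_subsetI)?)
  fix b assume b: "b \<in> B"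
  let ?z = "pinv (sg b) x"
  have x: "sg b ?z = x" using b by (simp add: surj_f_inv_f bij_is_surj)
  show "L x b \<in> B" "R_back ?z b \<in> B" using b L_B R_back_B by auto
  have "sg (R ?z b) ?z = x" using b x by (simp add: sg_R sg_gen_self)
  then have "pinv (sg (R ?z b)) x = ?z" using b by (metis R_B bij_inv_eq_iff sg_bij)
  then show "R_back (pinv (sg (L x b)) x) (L x b) = b" using b by (simp add: L_def R_back_R)
  have "sg b ?z = sg (R_back ?z b) ?z"
    using sg_R[OF R_back_B[OF b, of ?z], of ?z] unfolding R_R_back[OF b]
    by (metis o_apply sg_gen_self)
  then have "pinv (sg (R_back ?z b)) x = ?z" using b x by (metis R_back_B bij_inv_eq_iff sg_bij)
  then show "L x (R_back ?z b) = b" using b by (simp add: L_def R_R_back)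
qed

lemma L_R:
  assumes "b \<in> B" shows "L x (R y b) = R y (L x b)"
proof -
  have "pinv (sg (R y b)) x = pinv (sg (gen y)) (pinv (sg b) x)"
    using sg_R[OF assms] o_inv_distrib[OF sg_bij[OF assms] sg_bij[OF gen_B]] by simp
  then show ?thesis unfolding L_def using R_R[OF assms] by simp
qed

text \<open>
  Multiplication by a generator \<open>gen z\<close>, and by its inverse, is one of the maps \<open>R x\<close>, or the inverse of
  one, at each element of \<open>B\<close>.
\<close>

lemma B_minimal:
  assumes T: "T \<subseteq> B" "(id, id) \<in> T"
    and R: "\<And>x b. b \<in> T \<Longrightarrow> R x b \<in> T" and R': "\<And>x b. b \<in> B \<Longrightarrow> R x b \<in> T \<Longrightarrow> b \<in> T"
  shows "T = B"
proof -
  have gen: "b \<otimes>\<^bsub>P\<^esub> gen z \<in> T" if "b \<in> T" for b z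
    using R[OF that, of "fst b z"] inv_fst(1)[OF subsetD[OF T(1) that]] by (simp only: R_def)
  have gen': "b \<otimes>\<^bsub>P\<^esub> inv\<^bsub>P\<^esub> gen z \<in> T" if "b \<in> T" for b z
  proof -
    let ?c = "b \<otimes>\<^bsub>P\<^esub> inv\<^bsub>P\<^esub> gen z"
    have b: "b \<in> B" using that T by blast
    have c: "?c \<in> B" using b by (simp add: mult_B inv_B gen_B)
    have "R (fst ?c z) ?c = ?c \<otimes>\<^bsub>P\<^esub> gen z" using inv_fst(1)[OF c] by (simp only: R_def)
    also have "\<dots> = b"
      using B_perm[OF b] gen_closed[of z] by (simp add: PP.m_assoc del: perm_pairs_simps(1,4))
    finally have "R (fst ?c z) ?c \<in> T" using that by simp
    then show ?thesis by (rule R'[OF c])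
  qed
  have "\<forall>b\<in>T. b \<otimes>\<^bsub>P\<^esub> c \<in> T" if "c \<in> B" for c
    using that unfolding B_def
  proof (induction rule: generate.induct)
    case one
    show ?case
    proof
      fix b assume "b \<in> T"
      with T(1) B_perm have "b \<in> carrier P" by blast
      then show "b \<otimes>\<^bsub>P\<^esub> \<one>\<^bsub>P\<^esub> \<in> T" using PP.r_one[of b] \<open>b \<in> T\<close> by (simp only:)
    qed
  next
    case (eng c d)
    show ?case
    proof
      fix b assume "b \<in> T"
      moreover have "b \<in> B" "c \<in> B" "d \<in> B"
        using eng(1,2) \<open>b \<in> T\<close> T(1) by (auto simp only: B_def)
      then have "b \<in> carrier P" "c \<in> carrier P" "d \<in> carrier P" by (simp_all only: B_perm)
      ultimately show "b \<otimes>\<^bsub>P\<^esub> (c \<otimes>\<^bsub>P\<^esub> d) \<in> T"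
        using eng(3,4) PP.m_assoc[of b c d] by metis
    qed
  qed (use gen gen' in blast)+
  then have "c \<in> T" if "c \<in> B" for c
    using T(2) PP.l_one[OF B_perm[OF that]] that by (metis perm_pairs_simps(4))
  then show ?thesis using T(1) by blast
qed

sublocale commuting_translations B "(id, id)" R L
proof
  show "L i (id, id) = R i (id, id)" for i by (simp add: L_def)
qed (use one_B R_bij L_bij L_R B_minimal in blast)+

abbreviation A where "A \<equiv> translation_group"
abbreviation M where "M \<equiv> P\<lparr>carrier := B\<rparr>"

lemma mult_R_left: "a \<in> B \<Longrightarrow> b \<in> B \<Longrightarrow> a \<otimes>\<^bsub>P\<^esub> R x b = R (fst a x) (a \<otimes>\<^bsub>P\<^esub> b)"
  using B_perm gen_closed
  by (simp add: R_def o_inv_distrib PP.m_assoc del: perm_pairs_simps(1,4)) 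

text \<open>
  Left multiplication by \<open>a\<close> permutes the left translations through \<open>x \<mapsto> snd a x\<close>, which makes
  \<open>semilinear_map\<close> applicable.
\<close>

lemma mult_L_left:
  assumes "a \<in> B" "b \<in> B" shows "a \<otimes>\<^bsub>P\<^esub> L x b = L (snd a x) (a \<otimes>\<^bsub>P\<^esub> b)"
proof -
  have "pinv (sg (a \<otimes>\<^bsub>P\<^esub> b)) (snd a x) = fst a (pinv (sg b) x)"
    using assms by (simp add: inv_sg mult_B o_inv_distrib)
  then show ?thesis using assms by (simp add: L_def mult_R_left)
qed

theorem skew_left_brace: "skew_left_brace A M"
proof (intro skew_left_brace.intro skew_left_brace_axioms.intro)
  show A: "group A" by (rule group_translation_group)
  interpret A: group A by (rule A)
  show "group M" by (rule PP.subgroup_imp_group[OF subgroup_B])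
  show "carrier M = carrier A" by simp
  fix a b c assume abc: "a \<in> carrier A" "b \<in> carrier A" "c \<in> carrier A"
  then have [simp]: "a \<in> B" "b \<in> B" "c \<in> B" by simp_all
  have aP: "a \<in> carrier P" "inv\<^bsub>P\<^esub> a \<in> carrier P" using B_perm by (simp_all del: perm_pairs_simps)
  have "bij_betw (\<lambda>s. a \<otimes>\<^bsub>P\<^esub> s) B B"
    by (rule bij_betw_byWitness[where f' = "\<lambda>s. inv\<^bsub>P\<^esub> a \<otimes>\<^bsub>P\<^esub> s"])
      (use aP B_perm in \<open>auto simp: mult_B inv_B PP.m_assoc[symmetric] simp del: perm_pairs_simps\<close>)
  moreover have e: "a \<otimes>\<^bsub>P\<^esub> (id, id) = a" using PP.r_one[OF aP(1)] by simp
  ultimately have "\<exists>d\<in>B. a \<otimes>\<^bsub>P\<^esub> c = a \<otimes>\<^bsub>A\<^esub> d \<and> a \<otimes>\<^bsub>P\<^esub> (b \<otimes>\<^bsub>A\<^esub> c) = (a \<otimes>\<^bsub>P\<^esub> b) \<otimes>\<^bsub>A\<^esub> d"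
    using semilinear_map[of "\<lambda>s. a \<otimes>\<^bsub>P\<^esub> s" "snd a" b c] by (simp add: mult_L_left bij_is_surj e)
  then obtain d where d: "d \<in> B" "a \<otimes>\<^bsub>P\<^esub> c = a \<otimes>\<^bsub>A\<^esub> d" "a \<otimes>\<^bsub>P\<^esub> (b \<otimes>\<^bsub>A\<^esub> c) = (a \<otimes>\<^bsub>P\<^esub> b) \<otimes>\<^bsub>A\<^esub> d"
    by blast
  have "d = inv\<^bsub>A\<^esub> a \<otimes>\<^bsub>A\<^esub> (a \<otimes>\<^bsub>P\<^esub> c)"
    using d A.inv_solve_left[of d a "a \<otimes>\<^bsub>P\<^esub> c"] mult_B[of a c] by simp
  then show "a \<otimes>\<^bsub>M\<^esub> (b \<otimes>\<^bsub>A\<^esub> c) = (a \<otimes>\<^bsub>M\<^esub> b) \<otimes>\<^bsub>A\<^esub> inv\<^bsub>A\<^esub> a \<otimes>\<^bsub>A\<^esub> (a \<otimes>\<^bsub>M\<^esub> c)"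
    using d A.m_assoc[of "a \<otimes>\<^bsub>P\<^esub> b" "inv\<^bsub>A\<^esub> a" "a \<otimes>\<^bsub>P\<^esub> c"] A.inv_closed[of a]
      mult_B[of a b] mult_B[of a c] by simp
qed

sublocale brace: skew_left_brace A M
  by (rule skew_left_brace)

lemma R_one: "R x (id, id) = gen x"
  using PP.l_one[OF gen_closed[of x]] by (simp add: R_def inv_id)

lemma add_gen: "b \<in> B \<Longrightarrow> b \<otimes>\<^bsub>A\<^esub> gen x = R x b"
  using R_eq_mult[of b x] by (simp add: R_one)

lemma add_B: "b \<in> B \<Longrightarrow> c \<in> B \<Longrightarrow> b \<otimes>\<^bsub>A\<^esub> c \<in> B"
  using brace.add.m_closed[of b c] by simp

lemma sg_add:
  assumes b: "b \<in> B" and c: "c \<in> B" shows "sg (b \<otimes>\<^bsub>A\<^esub> c) = sg b \<circ> sg c"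
proof -
  have "{c \<in> B. sg (b \<otimes>\<^bsub>A\<^esub> c) = sg b \<circ> sg c} = B"
  proof (rule R_minimal)
    show "(id, id) \<in> {c \<in> B. sg (b \<otimes>\<^bsub>A\<^esub> c) = sg b \<circ> sg c}"
      using b one_B by (simp add: mult_translation_group translation_id)
    fix i s
    have eq: "sg (b \<otimes>\<^bsub>A\<^esub> R i s) = sg (b \<otimes>\<^bsub>A\<^esub> s) \<circ> sg (gen i)" "sg (R i s) = sg s \<circ> sg (gen i)"
      if "s \<in> B"
      using mult_R[OF b that] sg_R[OF add_B[OF b that]] sg_R[OF that] by simp_all
    show "R i s \<in> {c \<in> B. sg (b \<otimes>\<^bsub>A\<^esub> c) = sg b \<circ> sg c}"
      if s: "s \<in> {c \<in> B. sg (b \<otimes>\<^bsub>A\<^esub> c) = sg b \<circ> sg c}"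
    proof -
      have "s \<in> B" "sg (b \<otimes>\<^bsub>A\<^esub> s) = sg b \<circ> sg s" using s by simp_all
      then show ?thesis using eq[OF \<open>s \<in> B\<close>] R_B[OF \<open>s \<in> B\<close>, of i] by (simp add: comp_assoc)
    qed
    show "s \<in> {c \<in> B. sg (b \<otimes>\<^bsub>A\<^esub> c) = sg b \<circ> sg c}"
      if s: "s \<in> B" and Rs: "R i s \<in> {c \<in> B. sg (b \<otimes>\<^bsub>A\<^esub> c) = sg b \<circ> sg c}"
    proof -
      have "sg (b \<otimes>\<^bsub>A\<^esub> s) \<circ> sg (gen i) = (sg b \<circ> sg s) \<circ> sg (gen i)"
        using Rs eq[OF s] by (simp add: comp_assoc)
      then have "sg (b \<otimes>\<^bsub>A\<^esub> s) = sg b \<circ> sg s"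
        by (intro surj_fun_eq[OF bij_is_surj[OF sg_bij[OF gen_B[of i]]]]) simp
      then show ?thesis using s by simp
    qed
  qed simp
  then show ?thesis using c by blast
qed

lemma lam_gen:
  assumes b: "b \<in> B" shows "brace.lam b (gen x) = gen (fst b x)"
proof -
  have "b \<otimes>\<^bsub>A\<^esub> brace.lam b (gen x) = b \<otimes>\<^bsub>P\<^esub> gen x"
    using brace.mul_eq_add_lam[of b "gen x"] b gen_B by simp
  also have "\<dots> = R (fst b x) b" by (simp only: R_def inv_fst(1)[OF b])
  also have "\<dots> = b \<otimes>\<^bsub>A\<^esub> gen (fst b x)" by (rule add_gen[OF b, symmetric])
  finally show ?thesis using b gen_B brace.lam_closed[of b "gen x"] by simp
qed

lemma sg_lam:
  assumes b: "b \<in> B" and c: "c \<in> B"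
  shows "sg (brace.lam b c) (fst b t) = fst b (sg c t)"
proof -
  have "sg b \<circ> sg (brace.lam b c) = sg (b \<otimes>\<^bsub>P\<^esub> c)"
    using brace.mul_eq_add_lam[of b c] sg_add[of b "brace.lam b c"] brace.lam_closed[of b c] b c by simp
  also have "\<dots> = snd b \<circ> sg c \<circ> pinv (fst b)"
    using b c by (simp add: sg_def o_inv_distrib comp_assoc)
  finally have "sg b (sg (brace.lam b c) (fst b t)) = sg b (fst b (sg c t))"
    using b by (simp add: fun_eq_iff sg_def)
  then show ?thesis using b by (meson bij_is_inj injD sg_bij)
qed

lemma conj_gen:
  assumes a: "a \<in> B" shows "a \<otimes>\<^bsub>A\<^esub> gen x \<otimes>\<^bsub>A\<^esub> inv\<^bsub>A\<^esub> a = gen (sg a x)"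
proof -
  have "gen (sg a x) \<otimes>\<^bsub>A\<^esub> a = L (sg a x) a" using L_eq_mult[OF a] by (simp add: R_one)
  also have "\<dots> = a \<otimes>\<^bsub>A\<^esub> gen x" using a by (simp add: L_def add_gen bij_is_inj)
  finally show ?thesis
    using a gen_B brace.add.inv_solve_right[of "gen (sg a x)" "a \<otimes>\<^bsub>A\<^esub> gen x" a] add_B by simp
qed

text \<open>
  The product of the action \<open>sg a\<close> of \<open>(a, 1)\<close> and the action \<open>fst b\<close> of \<open>(1, b)\<close>.
\<close>

definition act where "act g x = sg (fst g) (fst (snd g) x)"

end

text \<open>
  Permutations of a set \<open>X\<close> are extended by the identity outside \<open>X\<close>, so that inverses and composites can
  be taken on the whole type. The points outside \<open>X\<close> contribute only trivial generators.
\<close>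

locale square_free_permutations_on = square_free_permutations f h
  for f h :: "'x \<Rightarrow> 'x \<Rightarrow> 'x" +
  fixes X :: "'x set"
  assumes X_nonempty: "X \<noteq> {}"
    and f_outside: "y \<notin> X \<Longrightarrow> f x y = y" and h_outside: "y \<notin> X \<Longrightarrow> h x y = y"
    and gen_outside: "x \<notin> X \<Longrightarrow> f x = id \<and> h x = id"
begin

lemma B_outside:
  assumes "b \<in> B" "y \<notin> X" shows "fst b y = y \<and> snd b y = y"
  using assms(1) unfolding B_def
proof (induction rule: generate.induct)
  case (incl b)
  then show ?case using f_outside h_outside assms(2) by auto
next
  case (inv b)
  then obtain x where b: "b = gen x" by auto
  have "pinv (f x) y = y" "pinv (h x) y = y"
    using f_outside[OF assms(2), of x] h_outside[OF assms(2), of x] by (metis inv_fh)+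
  then show ?case using b by (simp add: perm_pairs_inv bij_f bij_h)
qed simp_all

lemma fst_X: "b \<in> B \<Longrightarrow> y \<in> X \<Longrightarrow> fst b y \<in> X"
  by (metis B_outside inv_fst(1))

lemma sg_X: "b \<in> B \<Longrightarrow> y \<in> X \<Longrightarrow> sg b y \<in> X"
  by (metis B_outside inv_fst(1,2,3) sg_def o_apply)

lemma generate_gen: "generate A (gen ` X) = B"
proof (rule R_minimal)
  have gX: "gen ` X \<subseteq> carrier A" using gen_B by auto
  have sub: "subgroup (generate A (gen ` X)) A" by (rule brace.add.generate_is_subgroup[OF gX])
  show "generate A (gen ` X) \<subseteq> B" using brace.add.generate_incl[OF gX] by simp
  show one: "(id, id) \<in> generate A (gen ` X)" using generate.one[of A "gen ` X"] by simp
  have gen: "gen i \<in> generate A (gen ` X)" for i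
  proof (cases "i \<in> X")
    case True
    then show ?thesis by (intro generate.incl imageI)
  next
    case False
    then have "gen i = (id, id)" using gen_outside[of i] by (simp add: gen_def)
    then show ?thesis using one by simp
  qed
  fix i s
  show "R i s \<in> generate A (gen ` X)" if s: "s \<in> generate A (gen ` X)"
    using generate.eng[OF s gen[of i]] add_gen[of s i] subgroup.mem_carrier[OF sub s] by simp
  show "s \<in> generate A (gen ` X)" if s: "s \<in> B" and Rs: "R i s \<in> generate A (gen ` X)"
  proof -
    have "R i s \<otimes>\<^bsub>A\<^esub> inv\<^bsub>A\<^esub> gen i \<in> generate A (gen ` X)"
      by (rule generate.eng[OF Rs subgroup.m_inv_closed[OF sub gen]])
    moreover have "s = R i s \<otimes>\<^bsub>A\<^esub> inv\<^bsub>A\<^esub> gen i"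
      using s gen_B R_B brace.add.inv_solve_right[of s "R i s" "gen i"] add_gen[OF s] by simp
    ultimately show ?thesis by simp
  qed
qed

lemma faithful:
  assumes b: "b \<in> B" and triv: "\<And>x. x \<in> X \<Longrightarrow> act (\<one>\<^bsub>A\<^esub>, b) x = x \<and> act (b, b) x = x"
  shows "b = \<one>\<^bsub>A\<^esub>"
proof -
  have "fst b x = x \<and> snd b x = x" for x
    using triv[of x] B_outside[OF b, of x] b by (cases "x \<in> X") (auto simp: act_def sg_def)
  then show ?thesis by (simp add: prod_eq_iff fun_eq_iff)
qed

lemma labelled_action: "labelled_brace_action A M X act gen"
proof (unfold_locales, goal_cases)
  case 1
  show ?case by (rule X_nonempty)
next
  case (2 g x)
  then obtain a b where "g = (a, b)" "a \<in> B" "b \<in> B" by auto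
  then show ?case using fst_X[of b x] sg_X[of a "fst b x"] 2 by (simp add: act_def)
next
  case (3 x)
  then show ?case by (simp add: act_def)
next
  case (4 g k x)
  then obtain a b c d where g: "g = (a, b)" "k = (c, d)" "a \<in> B" "b \<in> B" "c \<in> B" "d \<in> B" by auto
  then show ?case
    using sg_add[of a "brace.lam b c"] brace.lam_closed[of b c] sg_lam[of b c "fst d x"]
    by (simp add: act_def)
next
  case (5 x)
  then show ?case by (simp add: gen_B)
next
  case (6 g x)
  then obtain a b where g: "g = (a, b)" "a \<in> B" "b \<in> B" by auto
  then show ?case by (simp add: act_def brace_Theta_def lam_gen conj_gen)
next
  case (7 x)
  then show ?case by (simp add: act_def f_self)
next
  case (8 x)
  then show ?case by (simp add: act_def f_self sg_gen_self)
qed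

end

section \<open>Square-free solutions as families of permutations\<close>

locale square_free_set =
  fixes X :: "'x set" and r :: "'x \<times> 'x \<Rightarrow> 'x \<times> 'x"
  assumes square_free: "square_free_solution X r"
begin

abbreviation lf :: "'x \<Rightarrow> 'x \<Rightarrow> 'x" where "lf x y \<equiv> fst (r (x, y))"
abbreviation rg :: "'x \<Rightarrow> 'x \<Rightarrow> 'x" where "rg y x \<equiv> snd (r (x, y))"

lemma lf_bij: "x \<in> X \<Longrightarrow> bij_betw (lf x) X X"
  and rg_bij: "y \<in> X \<Longrightarrow> bij_betw (rg y) X X"
  and r_self: "x \<in> X \<Longrightarrow> r (x, x) = (x, x)"
  and X_ne: "X \<noteq> {}"
  using square_free
  by (auto simp: square_free_solution_def nondegenerate_solution_def yb_solution_def)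

lemma lf_X: "x \<in> X \<Longrightarrow> y \<in> X \<Longrightarrow> lf x y \<in> X"
  and rg_X: "x \<in> X \<Longrightarrow> y \<in> X \<Longrightarrow> rg y x \<in> X"
  using lf_bij rg_bij bij_betwE by blast+

lemma lf_inj: "x \<in> X \<Longrightarrow> y \<in> X \<Longrightarrow> z \<in> X \<Longrightarrow> lf x y = lf x z \<Longrightarrow> y = z"
  using lf_bij[of x] unfolding bij_betw_def inj_on_def by blast

lemma yang_baxter:
  assumes "x \<in> X" "y \<in> X" "z \<in> X"
  shows lf_lf: "lf x (lf y z) = lf (lf x y) (lf (rg y x) z)"
    and rg_lf: "rg (lf (rg y x) z) (lf x y) = lf (rg (lf y z) x) (rg z y)"
    and rg_rg: "rg z (rg y x) = rg (rg z y) (rg (lf y z) x)"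
proof -
  have "yb_r1 r (yb_r2 r (yb_r1 r (x, y, z))) = yb_r2 r (yb_r1 r (yb_r2 r (x, y, z)))"
    using square_free assms
    by (simp add: square_free_solution_def nondegenerate_solution_def yb_solution_def)
  then have "lf (lf x y) (lf (rg y x) z) = lf x (lf y z)
    \<and> rg (lf (rg y x) z) (lf x y) = lf (rg (lf y z) x) (rg z y)
    \<and> rg z (rg y x) = rg (rg z y) (rg (lf y z) x)"
    by (simp add: yb_r1_def yb_r2_def split_def prod_eq_iff)
  then show "lf x (lf y z) = lf (lf x y) (lf (rg y x) z)"
    "rg (lf (rg y x) z) (lf x y) = lf (rg (lf y z) x) (rg z y)"
    "rg z (rg y x) = rg (rg z y) (rg (lf y z) x)" by (simp_all only:)
qed

text \<open>
  The middle component of the braid equation on \<open>(x, x, y)\<close> reads \<open>f\<^sub>u(v) = u\<close> for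
  \<open>u = g\<^bsub>f\<^sub>x y\<^esub>(x)\<close> and \<open>v = g\<^sub>y(x)\<close>. As \<open>f\<^sub>u(u) = u\<close> too, the injectivity of \<open>f\<^sub>u\<close> gives \<open>u = v\<close>.
\<close>

lemma rg_lf_self:
  assumes x: "x \<in> X" and y: "y \<in> X"
  shows "rg (lf x y) x = rg y x"
proof -
  have self: "lf x x = x" "rg x x = x" using r_self[OF x] by simp_all
  let ?a = "rg (lf x y) x" and ?b = "rg y x"
  have X: "?a \<in> X" "?b \<in> X" using x y lf_X rg_X by simp_all
  have "lf ?a ?b = rg (lf x y) x"
    using rg_lf[OF x x y] unfolding self by (rule sym)
  also have "\<dots> = lf ?a ?a" using r_self[OF X(1)] by simp
  finally show ?thesis using lf_inj[OF X(1) X(2) X(1)] by simp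
qed

text \<open>
  This is the middle component of the braid equation on \<open>(x, t, z)\<close> with \<open>f\<^sub>t(z) = y\<close>, once \<open>rg_lf_self\<close> is used
  to replace the indices of the right maps and \<open>lf_lf\<close> to rewrite the left ones.
\<close>

lemma rack_identity:
  assumes x: "x \<in> X" and y: "y \<in> X" and t: "t \<in> X"
  shows "lf x (lf y (rg y t)) = lf (lf x y) (rg (lf x y) (lf x t))"
proof -
  have "y \<in> lf t ` X" using lf_bij[OF t] y unfolding bij_betw_def by blast
  then obtain z where z: "z \<in> X" "lf t z = y" by blast
  have a: "rg z t = rg y t" using rg_lf_self[OF t z(1)] unfolding z(2) by (rule sym)
  have xt: "lf x t \<in> X" "rg t x \<in> X" using x t lf_X rg_X by blast+
  have "rg (lf (rg t x) z) (lf x t) = rg (lf (lf x t) (lf (rg t x) z)) (lf x t)"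
    by (rule rg_lf_self[OF xt(1) lf_X[OF xt(2) z(1)], symmetric])
  also have "lf (lf x t) (lf (rg t x) z) = lf x y"
    using lf_lf[OF x t z(1)] unfolding z(2) by (rule sym)
  finally have "rg (lf x y) (lf x t) = lf (rg y x) (rg y t)"
    using rg_lf[OF x t z(1)] unfolding z(2) a by (rule trans[OF sym])
  then show ?thesis using lf_lf[OF x y rg_X[OF t y]] by (simp only:)
qed

text \<open>
  \<open>F\<close> and \<open>Gr\<close> extend the two components of the solution by the identity outside \<open>X\<close>, and \<open>H x\<close> is the
  inverse of \<open>Gr x\<close>.
\<close>

definition F :: "'x \<Rightarrow> 'x \<Rightarrow> 'x" where
  "F x y = (if x \<in> X \<and> y \<in> X then lf x y else y)"

definition H :: "'x \<Rightarrow> 'x \<Rightarrow> 'x" where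
  "H x y = (if x \<in> X \<and> y \<in> X then inv_into X (rg x) y else y)"

definition Gr :: "'x \<Rightarrow> 'x \<Rightarrow> 'x" where
  "Gr x y = (if x \<in> X \<and> y \<in> X then rg x y else y)"

lemma bij_extend:
  assumes "bij_betw p X X" shows "bij (\<lambda>y. if y \<in> X then p y else y)"
proof -
  have "bij_betw (\<lambda>y. if y \<in> X then p y else y) (X \<union> - X) (X \<union> - X)"
  proof (rule bij_betw_combine)
    show "bij_betw (\<lambda>y. if y \<in> X then p y else y) X X"
      using bij_betw_cong[of X "\<lambda>y. if y \<in> X then p y else y" p X] assms by simp
    show "bij_betw (\<lambda>y. if y \<in> X then p y else y) (- X) (- X)"
      by (simp add: bij_betw_def inj_on_def)
  qed simp
  then show ?thesis by simp
qed

lemma bij_F: "bij (F x)"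
proof (cases "x \<in> X")
  case True
  then have "F x = (\<lambda>y. if y \<in> X then lf x y else y)" by (auto simp: F_def)
  then show ?thesis using bij_extend[OF lf_bij[OF True]] by simp
next
  case False
  then have "F x = id" by (auto simp: F_def)
  then show ?thesis by simp
qed

lemma Gr_H: "Gr x (H x y) = y" and H_Gr: "H x (Gr x y) = y"
proof -
  have b: "bij_betw (rg x) X X" if "x \<in> X" using rg_bij[OF that] .
  show "Gr x (H x y) = y"
    using bij_betw_inv_into_right[OF b] bij_betwE[OF bij_betw_inv_into[OF b]]
    by (auto simp: Gr_def H_def)
  show "H x (Gr x y) = y"
    using bij_betw_inv_into_left[OF b] bij_betwE[OF b] by (auto simp: Gr_def H_def)
qed

lemma bij_H: "bij (H x)"
  by (rule o_bij[of "Gr x"]) (simp_all add: fun_eq_iff Gr_H H_Gr)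

lemma inv_H: "pinv (H x) = Gr x"
  by (rule inv_unique_comp) (simp_all add: fun_eq_iff Gr_H H_Gr)

lemma Gr_F: "Gr (F x y) x = Gr y x"
  using rg_lf_self[of x y] lf_X[of x y] by (auto simp: Gr_def F_def)

lemma permutations: "square_free_permutations_on F H X"
proof (unfold_locales, goal_cases)
  case (1 x)
  show ?case by (rule bij_F)
next
  case (2 x)
  show ?case by (rule bij_H)
next
  case (3 x)
  show ?case using r_self[of x] by (simp add: F_def)
next
  case (4 x)
  have "Gr x x = x" using r_self[of x] by (simp add: Gr_def)
  then show ?case using H_Gr[of x x] by simp
next
  case (5 x y)
  have "F x (F y z) = F (F x y) (F (Gr y x) z)" for z
    using lf_lf[of x y z] lf_X[of x y] lf_X[of y z] rg_X[of x y] lf_X[of "rg y x" z]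
    by (auto simp: F_def Gr_def)
  then show ?case by (simp add: fun_eq_iff inv_H Gr_F)
next
  case (6 x y)
  have *: "Gr y (Gr x z) = Gr (Gr y x) (Gr (F x y) z)" for z
    using rg_rg[of z x y] lf_X[of x y] rg_X[of z x] rg_X[of x y] rg_X[of z "lf x y"]
    by (auto simp: F_def Gr_def)
  have "H x (H y z) = H (F x y) (H (Gr y x) z)" for z
  proof -
    have "Gr (Gr y x) (Gr (F x y) (H x (H y z))) = z" by (simp only: Gr_H flip: *)
    then have "H (F x y) (H (Gr y x) (Gr (Gr y x) (Gr (F x y) (H x (H y z)))))
        = H (F x y) (H (Gr y x) z)" by (simp only:)
    then show ?thesis by (simp only: H_Gr)
  qed
  then show ?case by (simp add: fun_eq_iff inv_H Gr_F)
next
  case (7 x y z)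
  have *: "F x (F y (Gr y t)) = F (F x y) (Gr (F x y) (F x t))" for t
    using rack_identity[of x y t] lf_X[of x y] lf_X[of x t] rg_X[of t y]
      lf_X[of y "rg y t"] rg_X[of "lf x t" "lf x y"]
    by (auto simp: F_def Gr_def)
  have i: "pinv (F u) (F u v) = v" "F u (pinv (F u) v) = v" for u v
    using bij_F[of u] by (simp_all add: bij_is_inj bij_is_surj surj_f_inv_f)
  let ?t = "H y (pinv (F y) z)"
  have "F x z = F (F x y) (Gr (F x y) (F x ?t))" using *[of ?t] by (simp add: Gr_H i)
  then have "pinv (F (F x y)) (F x z) = Gr (F x y) (F x ?t)" by (simp add: i)
  then show ?case by (simp add: H_Gr)
next
  case 8
  show ?case by (rule X_ne)
qed (auto simp: F_def H_def)

sublocale perms: square_free_permutations_on F H X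
  by (rule permutations)

sublocale action: labelled_brace_action perms.A perms.M X perms.act perms.gen
  by (rule perms.labelled_action)

text \<open>
  The labels act on \<open>X\<close> by \<open>(1, gen x) \<mapsto> F x\<close> and \<open>(gen w, gen w) \<mapsto> H w\<close>. For \<open>w = lf x y\<close> the inverse of
  the latter takes \<open>x\<close> to \<open>rg w x\<close>, which is \<open>rg y x\<close> by \<open>rg_lf_self\<close>.
\<close>

lemma r_action:
  assumes x: "x \<in> X" and y: "y \<in> X"
  shows "r (x, y) = (perms.act (\<one>\<^bsub>perms.A\<^esub>, perms.gen x) y,
    perms.act (inv\<^bsub>perms.brace.G\<^esub> (perms.gen (perms.act (\<one>\<^bsub>perms.A\<^esub>, perms.gen x) y),
      perms.gen (perms.act (\<one>\<^bsub>perms.A\<^esub>, perms.gen x) y))) x)"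
proof -
  have f: "perms.act (\<one>\<^bsub>perms.A\<^esub>, perms.gen x) y = lf x y"
    using x y by (simp add: perms.act_def F_def)
  have w: "lf x y \<in> X" using x y by (rule lf_X)
  have gX: "rg y x \<in> X" using x y by (rule rg_X)
  have "perms.act (perms.gen (lf x y), perms.gen (lf x y)) (rg y x) = H (lf x y) (rg y x)"
    by (simp add: perms.act_def perms.sg_gen)
  also have "\<dots> = H (lf x y) (Gr (lf x y) x)"
    using rg_lf_self[OF x y] w x by (simp add: Gr_def)
  also have "\<dots> = x" by (rule H_Gr)
  finally have "perms.act (perms.gen (lf x y), perms.gen (lf x y)) (rg y x) = x" .
  then have "perms.act (inv\<^bsub>perms.brace.G\<^esub> (perms.gen (lf x y), perms.gen (lf x y))) x = rg y x"
    using action.act_inv_eq_iff[of "(perms.gen (lf x y), perms.gen (lf x y))" x "rg y x"]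
      x gX perms.gen_B by simp
  then show ?thesis unfolding f by simp
qed

theorem coset_representation:
  "square_free_brace_coset_data perms.A perms.M action.orbit_point action.orbit_index
     action.reps action.stab"
  "isomorphic_solutions X r
     (coset_carrier perms.A perms.M action.orbit_index action.reps action.stab)
     (coset_map perms.A perms.M action.orbit_point)"
proof -
  show "square_free_brace_coset_data perms.A perms.M action.orbit_point action.orbit_index
     action.reps action.stab"
  proof (rule action.coset_data_of_action)
    show "generate perms.A (perms.gen ` X) = carrier perms.A" by (simp add: perms.generate_gen)
    show "b = \<one>\<^bsub>perms.A\<^esub>" if "b \<in> carrier perms.A"
      "\<And>x. x \<in> X \<Longrightarrow> perms.act (\<one>\<^bsub>perms.A\<^esub>, b) x = x \<and> perms.act (b, b) x = x" for b
      using perms.faithful[of b] that by simp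
  qed
  show "isomorphic_solutions X r
     (coset_carrier perms.A perms.M action.orbit_index action.reps action.stab)
     (coset_map perms.A perms.M action.orbit_point)"
    by (rule action.isomorphic_coset_solution) (rule r_action)
qed

end

theorem proposition3p25:
  shows "(\<forall>(A :: 'b monoid) (M :: 'b monoid) (a :: 'b set \<Rightarrow> 'b) (I :: 'b set set)
           (J :: 'b set \<Rightarrow> 'j set) (K :: 'b set \<Rightarrow> 'j \<Rightarrow> ('b \<times> 'b) set).
          square_free_brace_coset_data A M a I J K \<longrightarrow>
          square_free_solution (coset_carrier A M I J K) (coset_map A M a))
       \<and> (\<forall>(X :: 'x set) (r :: 'x \<times> 'x \<Rightarrow> 'x \<times> 'x).
          square_free_solution X r \<longrightarrow>
          (\<exists>(A :: (('x \<Rightarrow> 'x) \<times> ('x \<Rightarrow> 'x)) monoid) (M :: (('x \<Rightarrow> 'x) \<times> ('x \<Rightarrow> 'x)) monoid)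
             (a :: (('x \<Rightarrow> 'x) \<times> ('x \<Rightarrow> 'x)) set \<Rightarrow> ('x \<Rightarrow> 'x) \<times> ('x \<Rightarrow> 'x))
             (I :: (('x \<Rightarrow> 'x) \<times> ('x \<Rightarrow> 'x)) set set)
             (J :: (('x \<Rightarrow> 'x) \<times> ('x \<Rightarrow> 'x)) set \<Rightarrow> 'x set)
             (K :: (('x \<Rightarrow> 'x) \<times> ('x \<Rightarrow> 'x)) set \<Rightarrow> 'x \<Rightarrow>
                ((('x \<Rightarrow> 'x) \<times> ('x \<Rightarrow> 'x)) \<times> (('x \<Rightarrow> 'x) \<times> ('x \<Rightarrow> 'x))) set).
             square_free_brace_coset_data A M a I J K \<and>
             isomorphic_solutions X r (coset_carrier A M I J K) (coset_map A M a)))"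
proof (intro conjI allI impI)
  fix A M :: "'b monoid" and a :: "'b set \<Rightarrow> 'b" and I :: "'b set set"
    and J :: "'b set \<Rightarrow> 'j set" and K :: "'b set \<Rightarrow> 'j \<Rightarrow> ('b \<times> 'b) set"
  assume "square_free_brace_coset_data A M a I J K"
  then show "square_free_solution (coset_carrier A M I J K) (coset_map A M a)"
    by (rule square_free_brace_coset_data.square_free_coset_solution)
next
  fix X :: "'x set" and r :: "'x \<times> 'x \<Rightarrow> 'x \<times> 'x"
  assume "square_free_solution X r"
  then have "square_free_set X r" by (rule square_free_set.intro)
  from square_free_set.coset_representation[OF this]
  show "\<exists>(A :: (('x \<Rightarrow> 'x) \<times> ('x \<Rightarrow> 'x)) monoid) (M :: (('x \<Rightarrow> 'x) \<times> ('x \<Rightarrow> 'x)) monoid)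
             (a :: (('x \<Rightarrow> 'x) \<times> ('x \<Rightarrow> 'x)) set \<Rightarrow> ('x \<Rightarrow> 'x) \<times> ('x \<Rightarrow> 'x))
             (I :: (('x \<Rightarrow> 'x) \<times> ('x \<Rightarrow> 'x)) set set)
             (J :: (('x \<Rightarrow> 'x) \<times> ('x \<Rightarrow> 'x)) set \<Rightarrow> 'x set)
             (K :: (('x \<Rightarrow> 'x) \<times> ('x \<Rightarrow> 'x)) set \<Rightarrow> 'x \<Rightarrow>
                ((('x \<Rightarrow> 'x) \<times> ('x \<Rightarrow> 'x)) \<times> (('x \<Rightarrow> 'x) \<times> ('x \<Rightarrow> 'x))) set).
             square_free_brace_coset_data A M a I J K \<and>
             isomorphic_solutions X r (coset_carrier A M I J K) (coset_map A M a)"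
    by (intro exI conjI)
qed

end
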